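(* Assume that the linear operator $\mathcal A$ satisfies the $\delta$-$\mathrm{RIP}_{2r}$ property with $\delta<1/2$. For every $\epsilon>0$ and $\kappa \geq 0$, with probability at least $\mathbb P(\|\mathbf A^Tw\| \leq \epsilon)$, the following holds: every matrix $\hat X \in \mathbb R^{n \times r}$ satisfying $$\|\nabla f(\hat X)\| \leq \kappa, \qquad \nabla^2f(\hat X) \succeq -\kappa I_{nr}$$ satisfies at least one of the two inequalities $$(1-\delta)\|\hat X\hat X^T-M^*\|_F^2 \leq \epsilon \sqrt{r}\, \|\hat X\hat X^T-M^*\|_F +\frac{r^{1/4}\kappa}{2} \|\hat X\hat X^T-M^*\|_F^{1/2}+\frac{r^{1/4}\kappa}{2} \|M^*\|_F^{1/2}+ \left(4 \sqrt r\, \epsilon + \frac{5\sqrt r\,\kappa}{2}\right)\|M^*\|_F,$$ $$\frac{2(1-2\delta)}{3(1+\delta)}\|\hat X\hat X^T-M^*\|_F \leq (2\epsilon+\kappa)\sqrt r+\sqrt{2\kappa(1+\delta)} +2\sqrt{2\epsilon(1+\delta)}\left(\|\hat X\hat X^T-M^*\|_F^{1/2}+\|M^*\|_F^{1/2}\right).$$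
   Context: Setting: $M^*\in\mathbb R^{n\times n}$ is a symmetric positive semidefinite matrix with $\mathrm{rank}(M^* )=r$ (the ground truth). $\mathcal A:\mathbb R^{n\times n}\to\mathbb R^m$ is the linear operator $\mathcal A(M)=[\langle A_1,M\rangle,\dots,\langle A_m,M\rangle]^T$ with given sensing matrices $A_1,\dots,A_m\in\mathbb R^{n\times n}$, where $\langle A,B\rangle=\mathrm{tr}(A^TB)$. $b=\mathcal A(M^* )$, and $w$ is a random noise vector in $\mathbb R^m$ with an arbitrary probability distribution. The objective function is $f(X)=\frac12\|\mathcal A(XX^T)-b+w\|^2$ for $X\in\mathbb R^{n\times r}$; its gradient $\nabla f(X)\in\mathbb R^{nr}$ and Hessian $\nabla^2 f(X)\in\mathbb R^{nr\times nr}$ are taken with respect to $\mathrm{vec}(X)$, where $\mathrm{vec}$ stacks the columns of a matrix. The matrix $\mathbf A=[\mathrm{vec}(A_1),\dots,\mathrm{vec}(A_m)]^T\in\mathbb R^{m\times n^2}$ represents $\mathcal A$, i.e. $\mathbf A\,\mathrm{vec}(M)=\mathcal A(M)$. $\|\cdot\|$ is the Euclidean norm of a vector and $\|\cdot\|_F$ the Frobenius norm; $\succeq$ is the positive semidefinite order. RIP: for $\delta\in[0,1)$, $\mathcal A$ satisfies the $\delta$-$\mathrm{RIP}_{2r}$ property if $(1-\delta)\|M\|_F^2\le\|\mathcal A(M)\|^2\le(1+\delta)\|M\|_F^2$ for all $M\in\mathbb R^{n\times n}$ with $\mathrm{rank}(M)\le 2r$. *)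

theory Defs
  imports "HOL-Analysis.Analysis" "HOL-Probability.Probability"
begin

definition mat_inner :: "real^'c^'d \<Rightarrow> real^'c^'d \<Rightarrow> real" where
  "mat_inner A B = trace (transpose A ** B)"

definition frob_norm :: "real^'c^'d \<Rightarrow> real" where
  "frob_norm A = sqrt (mat_inner A A)"

lemma mat_inner_eq_inner: "mat_inner A B = A \<bullet> B"
proof -
  have "mat_inner A B = (\<Sum>j\<in>UNIV. \<Sum>i\<in>UNIV. A $ i $ j * B $ i $ j)"
    by (simp add: mat_inner_def trace_def matrix_matrix_mult_def transpose_def)
  also have "\<dots> = (\<Sum>i\<in>UNIV. \<Sum>j\<in>UNIV. A $ i $ j * B $ i $ j)"
    by (rule sum.swap)
  finally show ?thesis by (simp add: inner_vec_def)
qed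

lemma frob_norm_eq_norm: "frob_norm A = norm A"
  by (simp add: frob_norm_def mat_inner_eq_inner norm_eq_sqrt_inner)

text \<open>The column-stacking vectorization. Its entries are indexed by pairs (column, row), so that
  the lexicographic order of the index pairs is the order in which the columns are stacked.\<close>

definition vectorize :: "real^'c^'d \<Rightarrow> real^('c \<times> 'd)" where
  "vectorize X = (\<chi> p. X $ snd p $ fst p)"

definition unvectorize :: "real^('c \<times> 'd) \<Rightarrow> real^'c^'d" where
  "unvectorize v = (\<chi> i j. v $ (j, i))"

lemma unvectorize_vectorize [simp]: "unvectorize (vectorize X) = X"
  by (simp add: vectorize_def unvectorize_def vec_eq_iff)

lemma vectorize_unvectorize [simp]: "vectorize (unvectorize v) = v"
  by (simp add: vectorize_def unvectorize_def vec_eq_iff)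

definition pos_semidef :: "real^'k^'k \<Rightarrow> bool" where
  "pos_semidef A \<longleftrightarrow> transpose A = A \<and> (\<forall>x. 0 \<le> x \<bullet> (A *v x))"

definition psd_ge :: "real^'k^'k \<Rightarrow> real^'k^'k \<Rightarrow> bool"  (infix \<open>\<succeq>\<close> 50) where
  "A \<succeq> B \<longleftrightarrow> pos_semidef (A - B)"

definition gradient :: "(real^'k \<Rightarrow> real) \<Rightarrow> real^'k \<Rightarrow> real^'k" where
  "gradient F x = (THE D. GDERIV F x :> D)"

definition hessian :: "(real^'k \<Rightarrow> real) \<Rightarrow> real^'k \<Rightarrow> real^'k^'k" where
  "hessian F x = jacobian (gradient F) (at x)"

lemma gradient_eqI:
  assumes "GDERIV F x :> D"
  shows "gradient F x = D"
  unfolding gradient_def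
proof (rule the_equality)
  show "GDERIV F x :> D" by fact
next
  fix D' assume "GDERIV F x :> D'"
  then have "(\<lambda>h. h \<bullet> D') = (\<lambda>h. h \<bullet> D)"
    using assms unfolding gderiv_def by (rule has_derivative_unique)
  then show "D' = D"
    by (simp add: fun_eq_iff vector_eq_ldot)
qed

definition sensing_op :: "('m \<Rightarrow> real^'c^'d) \<Rightarrow> real^'c^'d \<Rightarrow> real^'m" where
  "sensing_op A M = (\<chi> k. mat_inner (A k) M)"

definition sensing_matrix :: "('m \<Rightarrow> real^'c^'d) \<Rightarrow> real^('c \<times> 'd)^'m" where
  "sensing_matrix A = (\<chi> k. vectorize (A k))"

lemma sensing_matrix_mult_vectorize: "sensing_matrix A *v vectorize M = sensing_op A M"
proof -
  have "(\<Sum>p\<in>UNIV. vectorize (A k) $ p * vectorize M $ p) = mat_inner (A k) M" for k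
  proof -
    have "(\<Sum>p\<in>UNIV. vectorize (A k) $ p * vectorize M $ p)
        = (\<Sum>j\<in>UNIV. \<Sum>i\<in>UNIV. A k $ i $ j * M $ i $ j)"
      unfolding sum.cartesian_product UNIV_Times_UNIV
      by (simp add: vectorize_def case_prod_beta)
    then show ?thesis
      by (simp add: mat_inner_def trace_def matrix_matrix_mult_def transpose_def)
  qed
  then show ?thesis
    by (simp add: vec_eq_iff sensing_matrix_def sensing_op_def matrix_vector_mult_def)
qed

definition RIP :: "real \<Rightarrow> nat \<Rightarrow> (real^'c^'d \<Rightarrow> real^'m) \<Rightarrow> bool" where
  "RIP \<delta> s \<A> \<longleftrightarrow> (\<forall>M. rank M \<le> s \<longrightarrow>
     (1 - \<delta>) * (frob_norm M)\<^sup>2 \<le> (norm (\<A> M))\<^sup>2 \<and>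
     (norm (\<A> M))\<^sup>2 \<le> (1 + \<delta>) * (frob_norm M)\<^sup>2)"

definition objective ::
    "('m \<Rightarrow> real^'n^'n) \<Rightarrow> real^'m \<Rightarrow> real^'m \<Rightarrow> real^'r^'n \<Rightarrow> real" where
  "objective A b w X = (1/2) * (norm (sensing_op A (X ** transpose X) - b + w))\<^sup>2"

text \<open>Gradient and Hessian of a function of a matrix, taken with respect to the vectorization.\<close>

definition vec_gradient :: "(real^'c^'d \<Rightarrow> real) \<Rightarrow> real^'c^'d \<Rightarrow> real^('c \<times> 'd)" where
  "vec_gradient f X = gradient (\<lambda>v. f (unvectorize v)) (vectorize X)"

definition vec_hessian :: "(real^'c^'d \<Rightarrow> real) \<Rightarrow> real^'c^'d \<Rightarrow> real^('c \<times> 'd)^('c \<times> 'd)" where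
  "vec_hessian f X = hessian (\<lambda>v. f (unvectorize v)) (vectorize X)"

end

theory Submission
  imports Defs
begin

text \<open>
  Write \<open>M = Z Z\<^sup>T\<close>, \<open>e = X X\<^sup>T - M\<close> and \<open>\<rho> = \<A>(e) + w\<close>. On the event \<open>\<parallel>\<^bold>A\<^sup>T w\<parallel> \<le> \<epsilon>\<close>
  the noise satisfies \<open>\<bar>\<langle>w, \<A> N\<rangle>\<bar> \<le> \<epsilon> \<parallel>N\<parallel>\<close>, and the hypotheses on \<open>X\<close> become the two inequalities
  \<open>\<langle>\<rho>, \<A>(X U\<^sup>T + U X\<^sup>T)\<rangle> \<le> \<kappa> \<parallel>U\<parallel>\<close> and
  \<open>\<parallel>\<A>(X U\<^sup>T + U X\<^sup>T)\<parallel>\<^sup>2 + 2 \<langle>\<rho>, \<A>(U U\<^sup>T)\<rangle> \<ge> - \<kappa> \<parallel>U\<parallel>\<^sup>2\<close> for all directions \<open>U\<close>. From here on the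
  argument is deterministic. Let \<open>v\<close> be a unit vector minimizing \<open>\<parallel>X v\<parallel>\<close> and \<open>b = \<parallel>X v\<parallel>\<^sup>2\<close>, so \<open>b\<close> is
  the smallest eigenvalue of \<open>X\<^sup>T X\<close>. The directions \<open>U = z v\<^sup>T\<close> move the smallest singular value of
  \<open>X\<close>; their contribution to the first term of the second-order condition is of order \<open>b\<close>, so the
  condition limits how negative \<open>\<langle>\<rho>, \<A>(z z\<^sup>T)\<rangle>\<close> can be (lemma \<open>curvature_bound\<close>).

  If \<open>(1 + \<delta>) b \<le> 2 \<epsilon> + \<kappa>\<close>, taking for \<open>z\<close> the columns of \<open>Z\<close> bounds \<open>- \<langle>\<rho>, \<A> M\<rangle>\<close>, taking
  \<open>U = X\<close> in the first-order condition bounds \<open>\<langle>\<rho>, \<A>(X X\<^sup>T)\<rangle>\<close>, and together they bound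
  \<open>\<parallel>\<A> e\<parallel>\<^sup>2 \<ge> (1 - \<delta>) \<parallel>e\<parallel>\<^sup>2\<close>. This is the first alternative (lemma \<open>small_stretch_bound\<close>).

  If \<open>(1 + \<delta>) b > 2 \<epsilon> + \<kappa>\<close>, then \<open>X\<close> has full column rank. Let \<open>Y\<close> be the part of a suitably rotated
  \<open>Z\<close> orthogonal to the column space of \<open>X\<close>. The error splits orthogonally as \<open>e = T - g\<close> with
  \<open>g = Y Y\<^sup>T\<close> and \<open>T = X U\<^sup>T + U X\<^sup>T\<close> tangent, where \<open>\<parallel>U\<parallel>\<close> is controlled by \<open>\<parallel>T\<parallel> / \<surd>(2 b)\<close> and
  \<open>b \<parallel>Y\<parallel>\<^sup>2 \<le> \<parallel>T\<parallel>\<^sup>2 + \<parallel>g\<parallel>\<^sup>2 / 4\<close> (lemma \<open>tangent_decomposition\<close>). Test \<open>\<A> e\<close> against \<open>h = 4 T - g\<close>: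
  the restricted isometry property gives \<open>\<langle>\<A> e, \<A> h\<rangle> \<ge> \<langle>e, h\<rangle> - \<delta> \<parallel>e\<parallel> \<parallel>h\<parallel>\<close>, while stationarity
  bounds \<open>\<langle>\<A> e, \<A> h\<rangle>\<close> by \<open>(1 + \<delta>) b \<parallel>Y\<parallel>\<^sup>2\<close> plus terms in \<open>\<epsilon>\<close> and \<open>\<kappa>\<close>. With \<open>a = \<parallel>g\<parallel>\<close>,
  \<open>c = \<parallel>T\<parallel>\<close>, \<open>\<langle>e, h\<rangle>\<close> equals \<open>a\<^sup>2 + 4 c\<^sup>2\<close> and the other noiseless terms are at most
  multiples of it; what remains is
  \<open>(1 - 5 \<delta>/4 - (1 + \<delta>)/4) (a\<^sup>2 + 4 c\<^sup>2) = 3/4 (1 - 2 \<delta>) (a\<^sup>2 + 4 c\<^sup>2)\<close>, which is where the threshold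
  \<open>1/2\<close> comes from. The weights \<open>4\<close> and \<open>1/4\<close> are exact for the extremal configuration
  \<open>\<parallel>g\<parallel> = 2 \<parallel>T\<parallel>\<close> of the noiseless problem at \<open>\<delta> = 1/2\<close>. This is the second alternative
  (lemma \<open>large_stretch_bound\<close>).

  For the probability statement the event must be measurable although it quantifies over all \<open>X\<close>.
  The stationarity conditions are closed in \<open>(X, w)\<close> and the set of \<open>X\<close> violating both alternatives is
  open, hence a countable union of compact sets; so the set of bad noise vectors is a countable union
  of projections of closed sets along compact ones (lemma \<open>borel_forall_closed_imp\<close>).
\<close>

section \<open>Inner products and ranks of matrices\<close>

lemma bounded_bilinear_matrix_mult:
  "bounded_bilinear ((**) :: real^'k^'n \<Rightarrow> real^'m^'k \<Rightarrow> real^'m^'n)"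
  unfolding bilinear_conv_bounded_bilinear[symmetric] bilinear_def
  by (auto intro!: linearI simp: vec_eq_iff matrix_matrix_mult_def sum.distrib sum_distrib_left
      algebra_simps)

interpretation matrix_mult: bounded_bilinear "(**) :: real^'k^'n \<Rightarrow> real^'m^'k \<Rightarrow> real^'m^'n"
  by (rule bounded_bilinear_matrix_mult)

lemma bounded_linear_transpose: "bounded_linear (transpose :: real^'m^'n \<Rightarrow> real^'n^'m)"
  unfolding linear_conv_bounded_linear[symmetric]
  by (auto intro!: linearI simp: vec_eq_iff transpose_def)

lemmas transpose_diff = linear_diff[OF bounded_linear.linear[OF bounded_linear_transpose]]
  and transpose_add = linear_add[OF bounded_linear.linear[OF bounded_linear_transpose]]

lemma inner_eq_trace: "A \<bullet> B = trace (transpose A ** B)" for A B :: "real^'m^'n"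
  by (simp add: mat_inner_eq_inner[symmetric] mat_inner_def)

lemma inner_transpose: "transpose A \<bullet> transpose B = A \<bullet> B" for A B :: "real^'m^'n"
  by (metis inner_commute inner_eq_trace trace_mul_sym transpose_transpose)

lemma norm_transpose: "norm (transpose A) = norm A" for A :: "real^'m^'n"
  by (simp add: norm_eq_sqrt_inner inner_transpose)

lemma inner_matrix_mult_left: "(A ** B) \<bullet> D = B \<bullet> (transpose A ** D)"
  for A :: "real^'k^'n" and B :: "real^'m^'k"
  by (simp add: inner_eq_trace matrix_transpose_mul matrix_mul_assoc)

lemma inner_matrix_mult_right: "(A ** B) \<bullet> D = A \<bullet> (D ** transpose B)"
  for A :: "real^'k^'n" and B :: "real^'m^'k"
proof -
  have "(A ** B) \<bullet> D = (transpose B ** transpose A) \<bullet> transpose D"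
    by (metis inner_transpose matrix_transpose_mul)
  also have "\<dots> = transpose A \<bullet> transpose (D ** transpose B)"
    by (simp add: inner_matrix_mult_left matrix_transpose_mul)
  finally show ?thesis by (simp add: inner_transpose)
qed

definition outer :: "real^'n \<Rightarrow> real^'m \<Rightarrow> real^'m^'n" where
  "outer x y = (\<chi> i j. x $ i * y $ j)"

lemma matrix_mult_transpose_outer:
  "X ** transpose (outer z v) = outer (X *v v) z" for X :: "real^'m^'n"
  by (simp add: vec_eq_iff outer_def matrix_matrix_mult_def matrix_vector_mult_def transpose_def
      sum_distrib_right sum_distrib_left algebra_simps)

lemma outer_mult_transpose_outer:
  "outer z v ** transpose (outer z v) = (v \<bullet> v) *\<^sub>R outer z z" for z :: "real^'n" and v :: "real^'m"
  by (simp add: vec_eq_iff outer_def matrix_matrix_mult_def transpose_def inner_vec_def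
      sum_distrib_right sum_distrib_left algebra_simps)

lemma transpose_outer: "transpose (outer x y) = outer y x"
  by (simp add: vec_eq_iff outer_def transpose_def)

lemma inner_outer: "outer a b \<bullet> outer c d = (a \<bullet> c) * (b \<bullet> d)"
  for a c :: "real^'n" and b d :: "real^'m"
  by (simp add: outer_def inner_vec_def sum_product mult_ac) (rule sum.swap)

lemma norm_outer: "norm (outer a b) = norm a * norm b" for a :: "real^'n" and b :: "real^'m"
  by (simp add: norm_eq_sqrt_inner inner_outer real_sqrt_mult)

lemma mult_transpose_eq_sum_outer:
  "Z ** transpose Z = (\<Sum>i\<in>UNIV. outer (column i Z) (column i Z))" for Z :: "real^'m^'n"
  by (simp add: vec_eq_iff outer_def matrix_matrix_mult_def transpose_def column_def sum_component)

lemma norm_power2_eq_sum_columns: "(norm Z)\<^sup>2 = (\<Sum>i\<in>UNIV. (norm (column i Z))\<^sup>2)"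
  for Z :: "real^'m^'n"
  unfolding power2_norm_eq_inner inner_vec_def column_def
  by (subst sum.swap) simp

lemma norm_gram_eq: "norm (Z ** transpose Z) = norm (transpose Z ** Z)" for Z :: "real^'m^'n"
  using inner_matrix_mult_left[of Z "transpose Z" "Z ** transpose Z"]
    inner_matrix_mult_right[of "transpose Z" Z "transpose Z ** Z"]
  by (simp add: norm_eq_sqrt_inner matrix_mul_assoc)

lemma inner_matrix_vector: "(A *v x) \<bullet> y = x \<bullet> (transpose A *v y)" for A :: "real^'m^'n"
  using dot_lmul_matrix[of y A x] by (simp add: inner_commute)

lemma inner_symmetric_matrix: "transpose M = M \<Longrightarrow> (M *v x) \<bullet> y = x \<bullet> (M *v y)"
  for M :: "real^'n^'n"
  by (simp add: inner_matrix_vector)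

lemma outer_mult_vector: "outer a b *v x = (b \<bullet> x) *\<^sub>R a" for a :: "real^'n" and b :: "real^'m"
  by (simp add: vec_eq_iff outer_def matrix_vector_mult_def inner_vec_def sum_distrib_right
      sum_distrib_left mult_ac)

lemma outer_mult_outer: "outer a b ** outer c d = (b \<bullet> c) *\<^sub>R outer a d"
  for a :: "real^'n" and b :: "real^'m" and d :: "real^'k"
  by (simp add: vec_eq_iff outer_def matrix_matrix_mult_def inner_vec_def sum_distrib_right
      sum_distrib_left mult_ac)

text \<open>Cauchy-Schwarz against the identity: \<open>\<parallel>Z\<parallel>\<^sup>2\<close> is the trace of \<open>Z\<^sup>T Z\<close>, a matrix of size equal to
  the number of columns, whose Frobenius norm agrees with that of \<open>Z Z\<^sup>T\<close>. Traces of
  positive semidefinite matrices of rank \<open>r\<close> are compared with Frobenius norms in this way.\<close>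

lemma norm_power2_le_norm_gram:
  "(norm Z)\<^sup>2 \<le> sqrt (real CARD('m)) * norm (Z ** transpose Z)" for Z :: "real^'m^'n"
proof -
  have n1: "norm (mat 1 :: real^'m^'m) = sqrt (real CARD('m))"
    by (simp add: norm_eq_sqrt_inner inner_vec_def mat_def if_distrib cong: if_cong)
  have "(norm Z)\<^sup>2 = (mat 1 :: real^'m^'m) \<bullet> (transpose Z ** Z)"
    using inner_matrix_mult_right[of Z "mat 1" Z] inner_matrix_mult_left[of Z "mat 1" Z]
    by (simp add: power2_norm_eq_inner)
  also have "\<dots> \<le> norm (mat 1 :: real^'m^'m) * norm (transpose Z ** Z)"
    by (rule norm_cauchy_schwarz)
  finally show ?thesis by (simp add: n1 norm_gram_eq)
qed

text \<open>The restricted isometry property is only ever applied to matrices whose columns lie in the span of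
  the columns of two \<open>n \<times> r\<close> matrices; this form makes that visible.\<close>

lemma rank_le_of_two_factors:
  fixes X Z :: "real^'r^'n" and B C :: "real^'m^'r"
  shows "rank (X ** B + Z ** C) \<le> 2 * CARD('r)"
proof -
  have cols: "columns X = (\<lambda>i. column i X) ` UNIV" "columns Z = (\<lambda>i. column i Z) ` UNIV"
    by (auto simp: columns_def)
  have "range (\<lambda>x. (X ** B + Z ** C) *v x) \<subseteq> span (columns X \<union> columns Z)"
  proof clarify
    fix x
    have "X *v (B *v x) \<in> span (columns X \<union> columns Z)"
      using matrix_vector_mult_in_columnspace[of X] span_mono[of "columns X" "columns X \<union> columns Z"]
      by blast
    moreover have "Z *v (C *v x) \<in> span (columns X \<union> columns Z)"
      using matrix_vector_mult_in_columnspace[of Z] span_mono[of "columns Z" "columns X \<union> columns Z"]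
      by blast
    ultimately show "(X ** B + Z ** C) *v x \<in> span (columns X \<union> columns Z)"
      by (simp add: matrix_vector_mult_add_rdistrib matrix_vector_mul_assoc[symmetric] span_add)
  qed
  then have "rank (X ** B + Z ** C) \<le> dim (span (columns X \<union> columns Z))"
    unfolding rank_dim_range by (rule dim_subset)
  also have "\<dots> \<le> card (columns X \<union> columns Z)"
    by (rule dim_le_card) (auto simp: cols)
  also have "\<dots> \<le> card (columns X) + card (columns Z)"
    by (rule card_Un_le)
  also have "\<dots> \<le> 2 * CARD('r)"
    unfolding cols mult_2 by (intro add_mono card_image_le) simp_all
  finally show ?thesis .
qed

section \<open>Factoring positive semidefinite matrices\<close>

lemma psd_quadratic_eq_0:
  fixes M :: "real^'n^'n"
  assumes "pos_semidef M" and "x \<bullet> (M *v x) = 0"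
  shows "M *v x = 0"
proof (rule ccontr)
  assume nz: "M *v x \<noteq> 0"
  define y where "y = M *v x"
  \<comment> \<open>Along \<open>y - s x\<close> the quadratic form is affine in \<open>s\<close> with slope \<open>- 2 (y \<bullet> y)\<close>; this \<open>s\<close> makes it
    equal to \<open>-1\<close>.\<close>
  define s where "s = (y \<bullet> (M *v y) + 1) / (2 * (y \<bullet> y))"
  have yy: "y \<bullet> y > 0" using nz by (simp add: y_def)
  have sym: "transpose M = M" using assms(1) by (simp add: pos_semidef_def)
  have "0 \<le> (y - s *\<^sub>R x) \<bullet> (M *v (y - s *\<^sub>R x))"
    using assms(1) by (simp add: pos_semidef_def)
  also have "\<dots> = y \<bullet> (M *v y) - 2 * s * (y \<bullet> y)"
    using assms(2) inner_symmetric_matrix[OF sym, of x y]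
    by (simp add: y_def[symmetric] matrix_vector_mult_diff_distrib matrix_vector_mult_scaleR
        inner_diff inner_commute)
  also have "\<dots> = -1" using yy by (simp add: s_def field_simps)
  finally show False by simp
qed

text \<open>One step of a pivot-free Cholesky factorization: with \<open>q = x \<bullet> M x > 0\<close>, subtract
  \<open>(M x) (M x)\<^sup>T / q\<close>. The result annihilates \<open>x\<close>, so its range lies in the range of \<open>M\<close> and is
  orthogonal to \<open>x\<close>, which excludes \<open>M x\<close>.\<close>

lemma psd_deflate:
  fixes M :: "real^'n^'n"
  assumes psd: "pos_semidef M" and nz: "M \<noteq> 0"
  obtains z where "pos_semidef (M - outer z z)" "rank (M - outer z z) < rank M"
proof -
  have sym: "transpose M = M" using psd by (simp add: pos_semidef_def)
  obtain x where x: "M *v x \<noteq> 0"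
    using nz by (metis matrix_eq matrix_vector_mult_0)
  define q where "q = x \<bullet> (M *v x)"
  have q: "q > 0"
    using psd psd_quadratic_eq_0[OF psd, of x] x unfolding q_def pos_semidef_def
    by (metis order_le_less)
  define z where "z = (1 / sqrt q) *\<^sub>R (M *v x)"
  define N where "N = M - outer z z"
  have Nv: "N *v y = M *v y - ((M *v x) \<bullet> y / q) *\<^sub>R (M *v x)" for y
    using q by (simp add: N_def z_def matrix_vector_mult_diff_rdistrib outer_mult_vector
        field_simps)
  have symN: "transpose N = N"
    by (simp add: N_def transpose_diff transpose_outer sym)
  have Nx: "N *v x = 0"
    using q by (simp add: Nv q_def inner_commute)
  have "0 \<le> y \<bullet> (N *v y)" for y
  proof -
    \<comment> \<open>The form of \<open>N\<close> at \<open>y\<close> is the minimum of that of \<open>M\<close> along the line \<open>y - t x\<close>.\<close>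
    define t where "t = (M *v x) \<bullet> y / q"
    have "0 \<le> (y - t *\<^sub>R x) \<bullet> (M *v (y - t *\<^sub>R x))"
      using psd by (simp add: pos_semidef_def)
    also have "\<dots> = y \<bullet> (M *v y) - 2 * t * ((M *v x) \<bullet> y) + t\<^sup>2 * q"
      using inner_symmetric_matrix[OF sym, of x y]
      by (simp add: matrix_vector_mult_diff_distrib matrix_vector_mult_scaleR inner_diff
          inner_commute q_def power2_eq_square algebra_simps)
    also have "\<dots> = y \<bullet> (N *v y)"
      using q by (simp add: Nv t_def inner_diff inner_commute power2_eq_square field_simps)
    finally show ?thesis .
  qed
  then have "pos_semidef N" using symN by (simp add: pos_semidef_def)
  moreover have "rank N < rank M"
  proof -
    have "N *v y \<in> range ((*v) M)" for y
    proof -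
      have "N *v y = M *v (y - ((M *v x) \<bullet> y / q) *\<^sub>R x)"
        by (simp add: Nv matrix_vector_mult_diff_distrib matrix_vector_mult_scaleR)
      then show ?thesis by simp
    qed
    moreover have "M *v x \<notin> range ((*v) N)"
    proof
      assume "M *v x \<in> range ((*v) N)"
      then obtain y where "M *v x = N *v y" by auto
      then have "q = (N *v x) \<bullet> y"
        by (simp add: q_def inner_symmetric_matrix[OF symN])
      then show False using q Nx by simp
    qed
    ultimately have "range ((*v) N) \<subset> range ((*v) M)" by blast
    moreover have "subspace (range ((*v) A))" for A :: "real^'n^'n"
      by (rule linear_subspace_image) auto
    ultimately show ?thesis
      unfolding rank_dim_range by (intro dim_psubset) (simp add: span_eq_iff[THEN iffD2])
  qed
  ultimately show ?thesis using that unfolding N_def by blast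
qed

lemma psd_sum_outer:
  fixes M :: "real^'n^'n"
  assumes "pos_semidef M" and "rank M \<le> k"
  shows "\<exists>z. M = (\<Sum>i<k. outer (z i) (z i))"
  using assms
proof (induction k arbitrary: M)
  case 0
  then show ?case by (simp add: rank_eq_0)
next
  case (Suc k)
  show ?case
  proof (cases "M = 0")
    case True
    then show ?thesis
      by (intro exI[of _ "\<lambda>_. 0"]) (simp add: outer_def vec_eq_iff)
  next
    case False
    obtain u where u: "pos_semidef (M - outer u u)" "rank (M - outer u u) < rank M"
      using psd_deflate[OF Suc.prems(1) False] by blast
    then obtain z where "M - outer u u = (\<Sum>i<k. outer (z i) (z i))"
      using Suc.IH[of "M - outer u u"] Suc.prems(2) by auto
    then have "M = (\<Sum>i<Suc k. outer ((z(k := u)) i) ((z(k := u)) i))"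
      by (simp add: algebra_simps)
    then show ?thesis by blast
  qed
qed

lemma psd_factorization:
  fixes M :: "real^'n^'n"
  assumes "pos_semidef M" and "rank M \<le> CARD('r::finite)"
  obtains Z :: "real^'r^'n" where "M = Z ** transpose Z"
proof -
  obtain z where z: "M = (\<Sum>i<CARD('r). outer (z i) (z i))"
    using psd_sum_outer[OF assms] by blast
  obtain h where h: "bij_betw h (UNIV :: 'r set) {..<CARD('r)}"
    using ex_bij_betw_finite_nat[of "UNIV :: 'r set"] by (auto simp: atLeast0LessThan)
  define Z :: "real^'r^'n" where "Z = (\<chi> i j. z (h j) $ i)"
  have "column j Z = z (h j)" for j
    by (simp add: Z_def column_def)
  then have "Z ** transpose Z = (\<Sum>j\<in>UNIV. outer (z (h j)) (z (h j)))"
    by (simp add: mult_transpose_eq_sum_outer)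
  also have "\<dots> = M"
    unfolding z by (rule sum.reindex_bij_betw[OF h])
  finally show ?thesis using that by metis
qed

section \<open>Orthonormal and symmetric factors\<close>

text \<open>\<open>Q\<close> is an orthonormal basis of the column space of \<open>X\<close>, and \<open>B\<close> is the inverse of the
  coordinate matrix \<open>Q\<^sup>T X\<close>, so that also \<open>X = Q (Q\<^sup>T X)\<close>.\<close>

lemma ex_orthonormal_factor:
  fixes X :: "real^'r^'n"
  assumes "\<And>v. X *v v = 0 \<Longrightarrow> v = 0"
  obtains Q :: "real^'r^'n" and B :: "real^'r^'r"
  where "transpose Q ** Q = mat 1" "Q = X ** B" "B ** (transpose Q ** X) = mat 1"
proof -
  let ?S = "range ((*v) X)"
  have "inj ((*v) X)"
    by (subst linear_injective_0) (use assms in auto)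
  then have "dim ?S = CARD('r)"
    by (metis full_rank_injective rank_dim_range)
  moreover have "subspace ?S"
    by (rule linear_subspace_image) auto
  ultimately obtain E where E: "E \<subseteq> ?S" "pairwise orthogonal E" "\<And>x. x \<in> E \<Longrightarrow> norm x = 1"
      "independent E" "card E = CARD('r)"
    using orthonormal_basis_subspace by metis
  then obtain g where g: "bij_betw g (UNIV :: 'r set) E"
    using finite_same_card_bij[of "UNIV :: 'r set" E] independent_imp_finite by auto
  have gE: "g j \<in> E" for j
    using g by (auto simp: bij_betw_def)
  then have "\<forall>j. \<exists>c. g j = X *v c" using E(1) by blast
  then obtain c where c: "\<And>j. g j = X *v c j" by metis
  define Q :: "real^'r^'n" where "Q = (\<chi> i j. g j $ i)"
  define B :: "real^'r^'r" where "B = (\<chi> i j. c j $ i)"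
  have QX: "Q = X ** B"
    by (simp add: vec_eq_iff Q_def B_def c matrix_matrix_mult_def matrix_vector_mult_def)
  have "g i \<bullet> g j = (if i = j then 1 else 0)" for i j
  proof (cases "i = j")
    case True
    then show ?thesis using E(3)[OF gE] by (simp add: norm_eq_1)
  next
    case False
    then have "g i \<noteq> g j" using g by (auto simp: bij_betw_def inj_def)
    then show ?thesis using E(2) gE False by (auto simp: pairwise_def orthogonal_def)
  qed
  then have QQ: "transpose Q ** Q = mat 1"
    by (simp add: vec_eq_iff Q_def matrix_matrix_mult_def transpose_def mat_def inner_vec_def)
  then have "(transpose Q ** X) ** B = mat 1"
    by (simp add: QX matrix_mul_assoc[symmetric])
  then have "B ** (transpose Q ** X) = mat 1"
    by (simp add: matrix_left_right_inverse)
  then show ?thesis using that QQ QX by blast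
qed

lemma compact_orthogonal_matrices: "compact {R :: real^'r^'r. orthogonal_matrix R}"
proof -
  have "norm R = norm (mat 1 :: real^'r^'r)" if "orthogonal_matrix R" for R :: "real^'r^'r"
    using that by (simp add: norm_eq_sqrt_inner inner_eq_trace orthogonal_matrix)
  then have "bounded {R :: real^'r^'r. orthogonal_matrix R}"
    by (intro boundedI[of _ "norm (mat 1 :: real^'r^'r)"]) simp
  moreover have "closed {R :: real^'r^'r. orthogonal_matrix R}"
    unfolding orthogonal_matrix
    by (intro closed_Collect_eq continuous_intros matrix_mult.continuous_on
        bounded_linear.continuous_on[OF bounded_linear_transpose])
  ultimately show ?thesis by (simp add: compact_eq_bounded_closed)
qed

text \<open>The symmetric half of the polar decomposition, obtained variationally: \<open>R\<close> maximizes the trace of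
  \<open>K R\<close> over the compact orthogonal group. Multiplying by a rotation \<open>G\<close> through the angle \<open>\<theta>\<close> in a
  coordinate plane cannot increase the trace, and the derivative at \<open>\<theta> = 0\<close> is the difference of two
  opposite entries of \<open>K R\<close>.\<close>

lemma ex_orthogonal_symmetric:
  fixes K :: "real^'r^'r"
  obtains R where "orthogonal_matrix R" "transpose (K ** R) = K ** R"
proof -
  let ?O = "{R :: real^'r^'r. orthogonal_matrix R}"
  have tr: "trace (K ** R) = transpose K \<bullet> R" for R
    by (simp add: inner_eq_trace)
  have "continuous_on ?O (\<lambda>R. trace (K ** R))"
    unfolding tr by (intro continuous_intros)
  moreover have "?O \<noteq> {}" using orthogonal_matrix_id by blast
  ultimately obtain R where R: "orthogonal_matrix R"
      and max: "\<And>R'. orthogonal_matrix R' \<Longrightarrow> trace (K ** R') \<le> trace (K ** R)"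
    using continuous_attains_sup[OF compact_orthogonal_matrices] by (metis mem_Collect_eq)
  define L where "L = K ** R"
  have "L $ i $ j = L $ j $ i" for i j
  proof (cases "i = j")
    case False
    define a b :: "real^'r" where "a = axis i 1" and "b = axis j 1"
    define P S where "P = outer a a + outer b b" and "S = outer a b - outer b a"
    have ab: "a \<bullet> a = 1" "b \<bullet> b = 1" "a \<bullet> b = 0" "b \<bullet> a = 0"
      using False by (auto simp: a_def b_def inner_axis_axis)
    have PS: "P ** P = P" "P ** S = S" "S ** P = S" "S ** S = - P"
      by (simp_all add: P_def S_def matrix_mult.add_left matrix_mult.add_right
          matrix_mult.diff_left matrix_mult.diff_right outer_mult_outer ab)
    have PT: "transpose P = P" "transpose S = - S"
      by (simp_all add: P_def S_def transpose_add transpose_diff transpose_outer)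
    have gram: "(mat 1 + p *\<^sub>R P - q *\<^sub>R S) ** (mat 1 + p *\<^sub>R P + q *\<^sub>R S)
        = mat 1 + (p + p + p\<^sup>2 + q\<^sup>2) *\<^sub>R P" for p q
      by (simp add: matrix_mult.add_left matrix_mult.add_right matrix_mult.diff_left
          matrix_mult.scaleR_left matrix_mult.scaleR_right PS power2_eq_square)
        (simp add: vec_eq_iff algebra_simps)
    define G where "G \<theta> = mat 1 + (cos \<theta> - 1) *\<^sub>R P + sin \<theta> *\<^sub>R S" for \<theta>
    have orth: "orthogonal_matrix (G \<theta>)" for \<theta>
    proof -
      have "transpose (G \<theta>) = mat 1 + (cos \<theta> - 1) *\<^sub>R P - sin \<theta> *\<^sub>R S"
        by (simp add: G_def transpose_add transpose_scalar PT)
      moreover have "(cos \<theta> - 1) + (cos \<theta> - 1) + (cos \<theta> - 1)\<^sup>2 + (sin \<theta>)\<^sup>2 = 0"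
        using sin_cos_squared_add[of \<theta>] by (simp add: power2_eq_square algebra_simps)
      ultimately show ?thesis
        using gram[of "cos \<theta> - 1" "sin \<theta>"] by (simp add: orthogonal_matrix G_def)
    qed
    have trace_LG: "trace (L ** G \<theta>)
        = trace L + (cos \<theta> - 1) * (transpose L \<bullet> P) + sin \<theta> * (transpose L \<bullet> S)" for \<theta>
      using inner_eq_trace[of "transpose L" "G \<theta>"] inner_eq_trace[of "transpose L" "mat 1"]
      by (simp add: G_def inner_add_right)
    define \<phi> where "\<phi> \<theta> = (cos \<theta> - 1) * (transpose L \<bullet> P) + sin \<theta> * (transpose L \<bullet> S)" for \<theta>
    have "\<phi> \<theta> \<le> \<phi> 0" for \<theta>
      using max[OF orthogonal_matrix_mul[OF R orth[of \<theta>]]] trace_LG[of \<theta>]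
      by (simp add: \<phi>_def L_def matrix_mul_assoc)
    moreover have "DERIV \<phi> 0 :> transpose L \<bullet> S"
      unfolding \<phi>_def by (auto intro!: derivative_eq_intros)
    ultimately have "transpose L \<bullet> S = 0"
      using DERIV_local_max[of \<phi> _ 0 1] by auto
    moreover have "transpose L \<bullet> outer (axis k 1) (axis l 1) = L $ l $ k" for k l
    proof -
      have "transpose L \<bullet> outer (axis k 1) (axis l 1)
          = (\<Sum>p\<in>UNIV. \<Sum>q\<in>UNIV. L $ q $ p * (axis k 1 $ p * axis l 1 $ q))"
        by (simp add: inner_vec_def transpose_def outer_def)
      also have "\<dots> = (\<Sum>p\<in>UNIV. if p = k then (\<Sum>q\<in>UNIV. if q = l then L $ q $ p else 0) else 0)"
        by (intro sum.cong) (auto simp: axis_def if_distrib cong: if_cong)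
      finally show ?thesis by simp
    qed
    ultimately show ?thesis
      by (simp add: S_def a_def b_def inner_diff_right)
  qed simp
  then have "transpose L = L" by (simp add: vec_eq_iff transpose_def)
  then show ?thesis using that R unfolding L_def by blast
qed

section \<open>Splitting the error along a factor\<close>

lemma norm_matrix_mult_ge:
  fixes C :: "real^'k^'n" and V :: "real^'m^'k"
  assumes "\<And>y. b * (norm y)\<^sup>2 \<le> (norm (C *v y))\<^sup>2"
  shows "b * (norm V)\<^sup>2 \<le> (norm (C ** V))\<^sup>2"
proof -
  have "column j (C ** V) = C *v column j V" for j
    by (simp add: vec_eq_iff column_def matrix_matrix_mult_def matrix_vector_mult_def)
  then show ?thesis
    unfolding norm_power2_eq_sum_columns sum_distrib_left
    by (auto intro!: sum_mono assms)
qed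

lemma norm_orthonormal_mult:
  fixes Q :: "real^'k^'n" and V :: "real^'m^'k"
  assumes "transpose Q ** Q = mat 1"
  shows "norm (Q ** V) = norm V"
  by (simp add: norm_eq_sqrt_inner inner_matrix_mult_left matrix_mul_assoc assms)

lemma norm_mult_orthonormal_transpose:
  fixes Q :: "real^'k^'n" and V :: "real^'k^'m"
  assumes "transpose Q ** Q = mat 1"
  shows "norm (V ** transpose Q) = norm V"
  using norm_orthonormal_mult[OF assms, of "transpose V"]
  by (metis matrix_transpose_mul norm_transpose transpose_transpose)

text \<open>A square matrix and its transpose have the same smallest singular value; in one direction
  this follows from \<open>\<parallel>C x\<parallel>\<^sup>2 = x \<bullet> C\<^sup>T C x\<close> and Cauchy-Schwarz.\<close>

lemma coercive_transpose:
  fixes C :: "real^'r^'r"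
  assumes b: "b > 0" and lower: "\<And>y. b * (norm y)\<^sup>2 \<le> (norm (C *v y))\<^sup>2"
    and inv: "C ** B = mat 1"
  shows "b * (norm y)\<^sup>2 \<le> (norm (transpose C *v y))\<^sup>2"
proof (cases "y = 0")
  case False
  define x where "x = B *v y"
  have y: "y = C *v x"
    by (simp add: x_def matrix_vector_mul_assoc inv)
  have "(norm y)\<^sup>2 = (C *v x) \<bullet> y"
    by (simp add: power2_norm_eq_inner y)
  also have "\<dots> = x \<bullet> (transpose C *v y)"
    by (rule inner_matrix_vector)
  also have "\<dots> \<le> norm x * norm (transpose C *v y)"
    by (rule norm_cauchy_schwarz)
  finally have "((norm y)\<^sup>2)\<^sup>2 \<le> (norm x * norm (transpose C *v y))\<^sup>2"
    by (intro power_mono) auto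
  then have "b * ((norm y)\<^sup>2)\<^sup>2 \<le> b * (norm x)\<^sup>2 * (norm (transpose C *v y))\<^sup>2"
    using b by (simp add: power_mult_distrib)
  also have "\<dots> \<le> (norm y)\<^sup>2 * (norm (transpose C *v y))\<^sup>2"
    using lower[of x] by (intro mult_right_mono) (auto simp: y)
  finally have "(norm y)\<^sup>2 * (b * (norm y)\<^sup>2) \<le> (norm y)\<^sup>2 * (norm (transpose C *v y))\<^sup>2"
    by (simp add: power2_eq_square mult_ac)
  then show ?thesis using False by simp
qed simp

text \<open>The error relative to \<open>X\<close> is a tangent matrix \<open>T = X U\<^sup>T + U X\<^sup>T\<close> minus a positive semidefinite
  matrix \<open>Y Y\<^sup>T\<close> supported on the orthogonal complement of the column space of \<open>X\<close>.

  The delicate conclusion is the bound on \<open>b \<parallel>Y\<parallel>\<^sup>2\<close>. Let \<open>X = Q C\<close> with \<open>Q\<close> orthonormal, and rotate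
  \<open>Z\<close> so that \<open>K = Q\<^sup>T Z\<close> is symmetric; this does not change \<open>Z Z\<^sup>T\<close>. With \<open>G = Y\<^sup>T Y\<close> and
  \<open>S = C C\<^sup>T - K K\<close> one finds \<open>\<parallel>T\<parallel>\<^sup>2 = \<parallel>S\<parallel>\<^sup>2 + 2 \<langle>K K, G\<rangle>\<close>. Symmetry of \<open>K\<close> makes the same matrix
  \<open>K K\<close> appear in \<open>S\<close> and in the cross term, so \<open>\<parallel>S\<parallel>\<^sup>2 \<ge> \<langle>S, G\<rangle> - \<parallel>G\<parallel>\<^sup>2 / 4\<close> turns the sum into
  \<open>\<langle>C C\<^sup>T, G\<rangle> + \<langle>K K, G\<rangle> - \<parallel>G\<parallel>\<^sup>2 / 4\<close>, whose first term is at least \<open>b \<parallel>Y\<parallel>\<^sup>2\<close>.\<close>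

lemma tangent_decomposition:
  fixes X Z\<^sub>0 :: "real^'r^'n"
  assumes b: "b > 0" and lower: "\<And>y. b * (norm y)\<^sup>2 \<le> (norm (X *v y))\<^sup>2"
  obtains Y U :: "real^'r^'n" and B C :: "real^'r^'r"
  where "X ** transpose X - Z\<^sub>0 ** transpose Z\<^sub>0 + Y ** transpose Y
      = X ** transpose U + U ** transpose X"
    and "(X ** transpose U + U ** transpose X) \<bullet> (Y ** transpose Y) = 0"
    and "transpose X ** Y = 0"
    and "b * (norm Y)\<^sup>2 \<le> (norm (X ** transpose U + U ** transpose X))\<^sup>2 + (norm (Y ** transpose Y))\<^sup>2 / 4"
    and "2 * b * (norm U)\<^sup>2 \<le> (norm (X ** transpose U + U ** transpose X))\<^sup>2"
    and "Y = X ** B + Z\<^sub>0 ** C"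
proof -
  have "v = 0" if "X *v v = 0" for v
    using lower[of v] b that by (simp add: mult_le_0_iff)
  then obtain Q :: "real^'r^'n" and B where QQ: "transpose Q ** Q = mat 1"
      and QX: "Q = X ** B" and BC: "B ** (transpose Q ** X) = mat 1"
    using ex_orthonormal_factor by blast
  define C where "C = transpose Q ** X"
  have XQ: "X = Q ** C"
    using BC unfolding QX C_def by (metis QX matrix_mul_assoc matrix_mul_rid)
  have CB: "C ** B = mat 1"
    using BC by (simp add: C_def matrix_left_right_inverse)
  obtain R where R: "orthogonal_matrix R"
      and "transpose ((transpose Q ** Z\<^sub>0) ** R) = (transpose Q ** Z\<^sub>0) ** R"
    using ex_orthogonal_symmetric by blast
  define Z where "Z = Z\<^sub>0 ** R"
  define K where "K = transpose Q ** Z"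
  have KT: "transpose K = K"
    using \<open>transpose ((transpose Q ** Z\<^sub>0) ** R) = (transpose Q ** Z\<^sub>0) ** R\<close>
    by (simp add: K_def Z_def matrix_mul_assoc)
  have ZZ: "Z ** transpose Z = Z\<^sub>0 ** transpose Z\<^sub>0"
    using R unfolding Z_def orthogonal_matrix_def
    by (metis matrix_mul_assoc matrix_mul_rid matrix_transpose_mul)
  define Y where "Y = Z - Q ** K"
  have QY: "transpose Q ** Y = 0"
    by (simp add: Y_def matrix_mult.diff_right matrix_mul_assoc QQ) (simp add: K_def)
  have YQ: "transpose Y ** Q = 0"
    using arg_cong[OF QY, of transpose]
    by (simp add: matrix_transpose_mul linear_0[OF bounded_linear.linear[OF bounded_linear_transpose]])
  have XY: "transpose X ** Y = 0"
    by (simp add: XQ matrix_transpose_mul matrix_mul_assoc[symmetric] QY)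
  define S where "S = C ** transpose C - K ** K"
  define W where "W = K ** transpose Y"
  have ST: "transpose S = S"
    by (simp add: S_def transpose_diff matrix_transpose_mul KT)
  have WQ: "W ** Q = 0"
    by (simp add: W_def matrix_mul_assoc[symmetric] YQ)
  have WT: "transpose W = Y ** K"
    by (simp add: W_def matrix_transpose_mul KT)
  \<comment> \<open>Split the tangent matrix evenly: \<open>Q D\<close> carries half of the symmetric block, so that \<open>Q D\<close> and
    its transpose add up to it. Balancing in this way gives the factor \<open>2\<close> in \<open>2 b \<parallel>U\<parallel>\<^sup>2 \<le> \<parallel>T\<parallel>\<^sup>2\<close>.\<close>
  define D where "D = (1/2) *\<^sub>R (S ** transpose Q) - W"
  define U where "U = transpose (B ** D)"
  define T where "T = X ** transpose U + U ** transpose X"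
  have XU: "X ** transpose U = (1/2) *\<^sub>R (Q ** S ** transpose Q) - Q ** W"
    by (simp add: U_def D_def QX[symmetric] matrix_mul_assoc matrix_mult.diff_right
        matrix_mult.scaleR_right)
  have "U ** transpose X = transpose (X ** transpose U)"
    by (simp add: matrix_transpose_mul)
  also have "\<dots> = (1/2) *\<^sub>R (Q ** S ** transpose Q) - transpose W ** transpose Q"
    by (simp add: XU transpose_diff transpose_scalar matrix_transpose_mul matrix_mul_assoc ST)
  finally have T_eq: "T = Q ** S ** transpose Q - Q ** W - transpose W ** transpose Q"
    by (simp add: T_def XU scaleR_left_distrib[symmetric])
  have ZYQ: "Z = Y + Q ** K" by (simp add: Y_def)
  have T_tangent: "X ** transpose X - Z\<^sub>0 ** transpose Z\<^sub>0 + Y ** transpose Y = T"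
  proof -
    have "Z ** transpose Z = Y ** transpose Y + transpose W ** transpose Q + Q ** W
        + Q ** (K ** K) ** transpose Q"
      by (subst (1 2) ZYQ)
        (simp add: transpose_add matrix_transpose_mul KT WT W_def matrix_mult.add_left
          matrix_mult.add_right matrix_mul_assoc)
    moreover have "X ** transpose X = Q ** (C ** transpose C) ** transpose Q"
      by (subst (1 2) XQ) (simp add: matrix_transpose_mul matrix_mul_assoc)
    ultimately show ?thesis
      unfolding ZZ[symmetric] T_eq S_def
      by (simp add: matrix_mult.diff_left matrix_mult.diff_right)
  qed
  have orth: "T \<bullet> (Y ** transpose Y) = 0"
  proof -
    have "(Q ** V) \<bullet> (Y ** transpose Y) = 0" for V :: "real^'n^'r"
      by (simp add: inner_matrix_mult_left matrix_mul_assoc QY)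
    moreover have "(transpose W ** transpose Q) \<bullet> (Y ** transpose Y) = 0"
      by (simp add: inner_matrix_mult_right matrix_mul_assoc[symmetric] YQ)
    ultimately show ?thesis
      unfolding T_eq by (simp add: inner_diff_left matrix_mul_assoc[symmetric])
  qed
  have SW: "(S ** transpose Q) \<bullet> W = 0"
    by (simp add: inner_matrix_mult_right WQ)
  have T_norm: "(norm T)\<^sup>2 = (norm S)\<^sup>2 + 2 * (norm W)\<^sup>2"
  proof -
    have 1: "(Q ** S ** transpose Q) \<bullet> (Q ** W) = 0"
      using inner_matrix_mult_left[of Q "S ** transpose Q" "Q ** W"]
      by (simp add: matrix_mul_assoc QQ SW)
    have 2: "(Q ** S ** transpose Q) \<bullet> (transpose W ** transpose Q) = 0"
      using 1 inner_transpose[of "Q ** S ** transpose Q" "Q ** W"]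
      by (simp add: matrix_transpose_mul ST matrix_mul_assoc)
    have "transpose Q ** transpose W = 0"
      using WQ by (metis matrix_transpose_mul QY WT matrix_mul_assoc matrix_mult.zero_left)
    then have 3: "(Q ** W) \<bullet> (transpose W ** transpose Q) = 0"
      by (simp add: inner_matrix_mult_left matrix_mul_assoc)
    have 4: "norm (Q ** S ** transpose Q) = norm S"
      by (simp add: norm_mult_orthonormal_transpose[OF QQ] norm_orthonormal_mult[OF QQ])
    have 5: "norm (transpose W ** transpose Q) = norm W" "norm (Q ** W) = norm W"
      by (simp_all add: norm_mult_orthonormal_transpose[OF QQ] norm_orthonormal_mult[OF QQ] norm_transpose)
    have "(norm (P - V - V'))\<^sup>2 = (norm P)\<^sup>2 + (norm V)\<^sup>2 + (norm V')\<^sup>2"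
      if "P \<bullet> V = 0" "P \<bullet> V' = 0" "V \<bullet> V' = 0" for P V V' :: "real^'n^'n"
      using that by (simp add: power2_norm_eq_inner inner_diff inner_commute)
    from this[OF 1 2 3] show ?thesis
      unfolding T_eq by (simp add: 4 5)
  qed
  have C_lower: "b * (norm y)\<^sup>2 \<le> (norm (C *v y))\<^sup>2" for y
  proof -
    have "norm (X *v y) = norm (C *v y)"
      using inner_matrix_vector[of Q "C *v y" "Q *v (C *v y)"]
      by (simp add: XQ norm_eq_sqrt_inner matrix_vector_mul_assoc QQ matrix_mul_assoc)
    then show ?thesis using lower[of y] by simp
  qed
  have Y_bound: "b * (norm Y)\<^sup>2 \<le> (norm T)\<^sup>2 + (norm (Y ** transpose Y))\<^sup>2 / 4"
  proof -
    define G where "G = transpose Y ** Y"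
    have "b * (norm Y)\<^sup>2 \<le> (norm (transpose C ** transpose Y))\<^sup>2"
      using norm_matrix_mult_ge[of b "transpose C" "transpose Y"]
        coercive_transpose[OF b C_lower CB] by (simp add: norm_transpose)
    also have "\<dots> = (C ** transpose C) \<bullet> G"
      using inner_matrix_mult_left[of "transpose C" "transpose Y" "transpose C ** transpose Y"]
        inner_matrix_mult_right[of "transpose Y" Y "C ** transpose C"]
      by (simp add: power2_norm_eq_inner G_def inner_commute matrix_mul_assoc)
    also have "\<dots> = S \<bullet> G + (norm W)\<^sup>2"
    proof -
      have "(K ** K) \<bullet> G = (norm W)\<^sup>2"
        using inner_matrix_mult_left[of K "transpose Y" "K ** transpose Y"]
          inner_matrix_mult_right[of "transpose Y" Y "K ** K"]
        by (simp add: power2_norm_eq_inner W_def G_def KT inner_commute matrix_mul_assoc)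
      then show ?thesis by (simp add: S_def inner_diff_left)
    qed
    also have "S \<bullet> G \<le> (norm S)\<^sup>2 + (norm G)\<^sup>2 / 4"
    proof -
      have "0 \<le> (norm (S - (1/2) *\<^sub>R G))\<^sup>2" by simp
      also have "\<dots> = (norm S)\<^sup>2 - S \<bullet> G + (norm G)\<^sup>2 / 4"
        unfolding power2_norm_eq_inner by (simp add: inner_diff inner_commute)
      finally show ?thesis by simp
    qed
    finally show ?thesis
      using zero_le_power2[of "norm W"] unfolding T_norm norm_gram_eq[of Y] G_def by linarith
  qed
  have U_bound: "2 * b * (norm U)\<^sup>2 \<le> (norm T)\<^sup>2"
  proof -
    have "b * (norm U)\<^sup>2 = b * (norm (B ** D))\<^sup>2"
      by (simp add: U_def norm_transpose)
    also have "\<dots> \<le> (norm (C ** (B ** D)))\<^sup>2"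
      by (rule norm_matrix_mult_ge[OF C_lower])
    also have "\<dots> = (norm D)\<^sup>2"
      by (simp add: matrix_mul_assoc CB)
    also have "\<dots> = (norm (S ** transpose Q))\<^sup>2 / 4 + (norm W)\<^sup>2"
      unfolding power2_norm_eq_inner D_def using SW by (simp add: inner_diff inner_commute)
    also have "\<dots> = (norm S)\<^sup>2 / 4 + (norm W)\<^sup>2"
      by (simp add: norm_mult_orthonormal_transpose[OF QQ])
    finally show ?thesis unfolding T_norm using zero_le_power2[of "norm S"] by linarith
  qed
  have "Y = X ** (- (B ** K)) + Z\<^sub>0 ** R"
    by (simp add: Y_def Z_def QX matrix_mult.minus_right matrix_mul_assoc)
  from that[OF T_tangent[unfolded T_def] orth[unfolded T_def] XY Y_bound[unfolded T_def]
      U_bound[unfolded T_def] this]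
  show ?thesis .
qed

section \<open>Restricted isometry and elementary estimates\<close>

text \<open>Polarization with the two arguments rescaled to equal norm, which avoids dividing by the norms.\<close>

lemma polarized_lower_bound:
  fixes L :: "'a::real_inner \<Rightarrow> 'b::real_inner"
  assumes lin: "linear L"
    and low: "\<And>p q. (1 - \<delta>) * (norm (p *\<^sub>R e + q *\<^sub>R h))\<^sup>2 \<le> (norm (L (p *\<^sub>R e + q *\<^sub>R h)))\<^sup>2"
    and up: "\<And>p q. (norm (L (p *\<^sub>R e + q *\<^sub>R h)))\<^sup>2 \<le> (1 + \<delta>) * (norm (p *\<^sub>R e + q *\<^sub>R h))\<^sup>2"
  shows "e \<bullet> h - \<delta> * norm e * norm h \<le> L e \<bullet> L h"
proof (cases "e = 0 \<or> h = 0")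
  case True
  then show ?thesis using linear_0[OF lin] by auto
next
  case False
  define a c where "a = norm e" and "c = norm h"
  have pos: "a > 0" "c > 0" using False by (auto simp: a_def c_def)
  have sq: "e \<bullet> e = a\<^sup>2" "h \<bullet> h = c\<^sup>2" by (simp_all add: a_def c_def power2_norm_eq_inner)
  have L: "L (p *\<^sub>R e + q *\<^sub>R h) = p *\<^sub>R L e + q *\<^sub>R L h" for p q
    by (simp add: linear_add[OF lin] linear_cmul[OF lin])
  have expand: "(norm (p *\<^sub>R x + q *\<^sub>R y))\<^sup>2 = p\<^sup>2 * (x \<bullet> x) + 2 * p * q * (x \<bullet> y) + q\<^sup>2 * (y \<bullet> y)"
    for p q and x y :: "'c::real_inner"
    unfolding power2_norm_eq_inner
    by (simp add: inner_add inner_commute power2_eq_square algebra_simps)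
  have "(1 - \<delta>) * (norm (c *\<^sub>R e + a *\<^sub>R h))\<^sup>2 - (1 + \<delta>) * (norm (c *\<^sub>R e + (- a) *\<^sub>R h))\<^sup>2
      \<le> (norm (L (c *\<^sub>R e + a *\<^sub>R h)))\<^sup>2 - (norm (L (c *\<^sub>R e + (- a) *\<^sub>R h)))\<^sup>2"
    by (intro diff_mono low up)
  then have "4 * (a * c) * (e \<bullet> h - \<delta> * a * c) \<le> 4 * (a * c) * (L e \<bullet> L h)"
    unfolding L expand sq by (simp add: algebra_simps power2_eq_square)
  then show ?thesis using pos by (simp add: a_def c_def)
qed

lemma ex_min_stretch:
  fixes X :: "real^'r^'n"
  obtains v where "norm v = 1" "\<And>y. (norm (X *v v))\<^sup>2 * (norm y)\<^sup>2 \<le> (norm (X *v y))\<^sup>2"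
proof -
  have "continuous_on (sphere 0 1) (\<lambda>v. norm (X *v v))"
    by (intro continuous_intros linear_continuous_on bounded_linear.linear) simp_all
  moreover have "sphere (0 :: real^'r) 1 \<noteq> {}"
    by simp
  ultimately obtain v where v: "v \<in> sphere 0 1" and
    min: "\<And>y. y \<in> sphere 0 1 \<Longrightarrow> norm (X *v v) \<le> norm (X *v y)"
    using continuous_attains_inf[OF compact_sphere] by metis
  have "norm (X *v v) * norm y \<le> norm (X *v y)" for y
  proof (cases "y = 0")
    case False
    have "norm (X *v v) \<le> norm (X *v ((1 / norm y) *\<^sub>R y))"
      using False by (intro min) simp
    then show ?thesis
      using False by (simp add: matrix_vector_mult_scaleR field_simps)
  qed simp
  then have "(norm (X *v v))\<^sup>2 * (norm y)\<^sup>2 \<le> (norm (X *v y))\<^sup>2" for y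
    unfolding power_mult_distrib[symmetric] by (intro power_mono) auto
  then show ?thesis using that v by simp
qed

text \<open>The factors on the left are the norms of \<open>4 T - g\<close> and \<open>T - g\<close> for orthogonal \<open>T\<close>, \<open>g\<close> of norms
  \<open>c\<close>, \<open>a\<close>. The difference of the squares of the two sides is a perfect square, zero at \<open>a = 2 c\<close>.\<close>

lemma two_norm_bound:
  fixes a c :: real
  shows "sqrt (a\<^sup>2 + 16 * c\<^sup>2) * sqrt (a\<^sup>2 + c\<^sup>2) \<le> 5/4 * (a\<^sup>2 + 4 * c\<^sup>2)"
proof -
  have "sqrt (a\<^sup>2 + 16 * c\<^sup>2) * sqrt (a\<^sup>2 + c\<^sup>2) = sqrt ((a\<^sup>2 + 16 * c\<^sup>2) * (a\<^sup>2 + c\<^sup>2))"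
    by (simp add: real_sqrt_mult)
  also have "\<dots> \<le> 5/4 * (a\<^sup>2 + 4 * c\<^sup>2)"
  proof (rule real_le_lsqrt)
    have "(5/4 * (a\<^sup>2 + 4 * c\<^sup>2))\<^sup>2 - (a\<^sup>2 + 16 * c\<^sup>2) * (a\<^sup>2 + c\<^sup>2) = (3/4 * a\<^sup>2 - 3 * c\<^sup>2)\<^sup>2"
      by (simp add: power2_eq_square algebra_simps)
    then show "(a\<^sup>2 + 16 * c\<^sup>2) * (a\<^sup>2 + c\<^sup>2) \<le> (5/4 * (a\<^sup>2 + 4 * c\<^sup>2))\<^sup>2"
      by (metis diff_ge_0_iff_ge zero_le_power2)
  qed auto
  finally show ?thesis .
qed

section \<open>Error bounds at approximate second-order stationary points\<close>

text \<open>Approximate second-order stationarity in terms of inner products only: what is left of the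
  optimization problem once the noise vector is fixed and gradient and Hessian are evaluated.\<close>

locale noisy_stationary_point =
  fixes L :: "real^'n^'n \<Rightarrow> real^'m" and M :: "real^'n^'n" and w :: "real^'m"
    and X :: "real^'r^'n" and \<delta> \<epsilon> \<kappa> :: real
  assumes linear_L: "linear L"
    and rip: "RIP \<delta> (2 * CARD('r)) L"
    and psd_M: "pos_semidef M" and rank_M: "rank M \<le> CARD('r)"
    and delta: "0 \<le> \<delta>" "\<delta> < 1/2" and kappa: "0 \<le> \<kappa>" and eps: "0 \<le> \<epsilon>"
    and noise: "\<And>N. \<bar>w \<bullet> L N\<bar> \<le> \<epsilon> * norm N"
    and first_order: "\<And>U. (L (X ** transpose X - M) + w) \<bullet> L (X ** transpose U + U ** transpose X)
        \<le> \<kappa> * norm U"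
    and second_order: "\<And>U. - \<kappa> * (norm U)\<^sup>2 \<le> (norm (L (X ** transpose U + U ** transpose X)))\<^sup>2
        + 2 * ((L (X ** transpose X - M) + w) \<bullet> L (U ** transpose U))"
begin

abbreviation "err \<equiv> X ** transpose X - M"
abbreviation "res \<equiv> L err + w"

lemma rip_lower: "rank N \<le> 2 * CARD('r) \<Longrightarrow> (1 - \<delta>) * (norm N)\<^sup>2 \<le> (norm (L N))\<^sup>2"
  and rip_upper: "rank N \<le> 2 * CARD('r) \<Longrightarrow> (norm (L N))\<^sup>2 \<le> (1 + \<delta>) * (norm N)\<^sup>2"
  using rip by (auto simp: RIP_def frob_norm_eq_norm)

text \<open>The second-order condition in the directions \<open>z v\<^sup>T\<close>, summed over the columns \<open>z\<close> of \<open>V\<close>. For these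
  \<open>X U\<^sup>T + U X\<^sup>T = (X v) z\<^sup>T + z (X v)\<^sup>T\<close>. The constant \<open>c\<close> is a parameter because the squared norm of
  this matrix is \<open>2 \<parallel>X v\<parallel>\<^sup>2 \<parallel>z\<parallel>\<^sup>2\<close> when \<open>z\<close> is orthogonal to \<open>X v\<close> but up to twice that in general.\<close>

lemma curvature_bound:
  fixes V :: "real^'r^'n"
  assumes v: "norm v = 1"
    and stretch: "\<And>i. (norm (outer (X *v v) (column i V) + outer (column i V) (X *v v)))\<^sup>2
        \<le> c * (norm (column i V))\<^sup>2"
  shows "- (res \<bullet> L (V ** transpose V)) \<le> ((1 + \<delta>) * c + \<kappa>) / 2 * (norm V)\<^sup>2"
proof -
  have column: "- 2 * (res \<bullet> L (outer z z)) \<le> ((1 + \<delta>) * c + \<kappa>) * (norm z)\<^sup>2"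
    if z: "z = column i V" for z i
  proof -
    define U where "U = outer z v"
    have XU: "X ** transpose U + U ** transpose X = outer (X *v v) z + outer z (X *v v)"
      using matrix_transpose_mul[of X "transpose U"]
      by (simp add: U_def matrix_mult_transpose_outer transpose_outer)
        (metis matrix_mult_transpose_outer matrix_transpose_mul transpose_outer transpose_transpose)
    have "rank (X ** transpose U + U ** transpose X) \<le> 2 * CARD('r)"
      by (rule rank_le_of_two_factors)
    then have "(norm (L (X ** transpose U + U ** transpose X)))\<^sup>2
        \<le> (1 + \<delta>) * (norm (X ** transpose U + U ** transpose X))\<^sup>2"
      by (rule rip_upper)
    also have "\<dots> \<le> (1 + \<delta>) * (c * (norm z)\<^sup>2)"
      unfolding XU z using delta by (intro mult_left_mono stretch) simp
    finally have "- \<kappa> * (norm z)\<^sup>2 \<le> (1 + \<delta>) * (c * (norm z)\<^sup>2) + 2 * (res \<bullet> L (outer z z))"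
      using second_order[of U] v
      by (simp add: U_def norm_outer outer_mult_transpose_outer norm_eq_1)
    then show ?thesis by (simp add: algebra_simps)
  qed
  have "- 2 * (res \<bullet> L (V ** transpose V))
      = (\<Sum>i\<in>UNIV. - 2 * (res \<bullet> L (outer (column i V) (column i V))))"
    unfolding mult_transpose_eq_sum_outer linear_sum[OF linear_L] inner_sum_right sum_distrib_left ..
  also have "\<dots> \<le> (\<Sum>i\<in>UNIV. ((1 + \<delta>) * c + \<kappa>) * (norm (column i V))\<^sup>2)"
    by (intro sum_mono column[OF refl])
  also have "\<dots> = ((1 + \<delta>) * c + \<kappa>) * (norm V)\<^sup>2"
    unfolding norm_power2_eq_sum_columns sum_distrib_left ..
  finally show ?thesis by simp
qed

text \<open>Since \<open>e = X X\<^sup>T - M\<close>, it suffices to estimate \<open>\<rho> = \<A>(e) + w\<close> against \<open>\<A>(X X\<^sup>T)\<close> and \<open>\<A> M\<close>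
  separately: first-order stationarity in the direction \<open>X\<close> handles the former, curvature along the
  columns of a factor of \<open>M\<close> the latter.\<close>

lemma small_stretch_bound:
  assumes v: "norm v = 1" and small: "(1 + \<delta>) * (norm (X *v v))\<^sup>2 \<le> 2 * \<epsilon> + \<kappa>"
  shows "(1 - \<delta>) * (norm err)\<^sup>2 \<le> \<epsilon> * norm err
    + \<kappa> / 2 * sqrt (sqrt (real CARD('r)) * (norm err + norm M))
    + sqrt (real CARD('r)) * (4 * \<epsilon> + 5 * \<kappa> / 2) * norm M"
proof -
  obtain Z :: "real^'r^'n" where Z: "M = Z ** transpose Z"
    using psd_factorization[OF psd_M rank_M] by blast
  let ?b = "(norm (X *v v))\<^sup>2"
  have "(norm (outer (X *v v) z + outer z (X *v v)))\<^sup>2 \<le> 4 * ?b * (norm z)\<^sup>2" for z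
  proof -
    have "norm (outer (X *v v) z + outer z (X *v v)) \<le> 2 * norm (X *v v) * norm z"
      using norm_triangle_ineq[of "outer (X *v v) z" "outer z (X *v v)"]
      by (simp add: norm_outer mult_ac)
    then have "(norm (outer (X *v v) z + outer z (X *v v)))\<^sup>2 \<le> (2 * norm (X *v v) * norm z)\<^sup>2"
      by (intro power_mono) auto
    then show ?thesis by (simp add: power_mult_distrib)
  qed
  from curvature_bound[OF v this, of Z]
  have "- (res \<bullet> L M) \<le> ((1 + \<delta>) * (4 * ?b) + \<kappa>) / 2 * (norm Z)\<^sup>2"
    by (simp add: Z[symmetric])
  also have "\<dots> \<le> (4 * \<epsilon> + 5 * \<kappa> / 2) * (norm Z)\<^sup>2"
    using small by (intro mult_right_mono) auto
  also have "\<dots> \<le> (4 * \<epsilon> + 5 * \<kappa> / 2) * (sqrt (real CARD('r)) * norm M)"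
    unfolding Z using norm_power2_le_norm_gram[of Z] eps kappa by (intro mult_left_mono) auto
  finally have resM: "- (res \<bullet> L M) \<le> (4 * \<epsilon> + 5 * \<kappa> / 2) * (sqrt (real CARD('r)) * norm M)" .
  have "2 * (res \<bullet> L (X ** transpose X)) \<le> \<kappa> * norm X"
    using first_order[of X] unfolding linear_add[OF linear_L] inner_add_right by linarith
  moreover have "norm X \<le> sqrt (sqrt (real CARD('r)) * (norm err + norm M))"
  proof -
    have "norm (X ** transpose X) \<le> norm err + norm M"
      using norm_triangle_ineq[of err M] by simp
    then have "(norm X)\<^sup>2 \<le> sqrt (real CARD('r)) * (norm err + norm M)"
      using norm_power2_le_norm_gram[of X] mult_left_mono[of _ _ "sqrt (real CARD('r))"]
      by (meson order_trans real_sqrt_ge_zero of_nat_0_le_iff)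
    then show ?thesis by (rule real_le_rsqrt)
  qed
  ultimately have resX: "res \<bullet> L (X ** transpose X)
      \<le> \<kappa> / 2 * sqrt (sqrt (real CARD('r)) * (norm err + norm M))"
    using mult_left_mono[OF _ kappa] by fastforce
  have "err = X ** transpose X + Z ** (- transpose Z)"
    by (simp add: Z matrix_mult.minus_right)
  then have "rank err \<le> 2 * CARD('r)"
    by (metis rank_le_of_two_factors)
  then have "(1 - \<delta>) * (norm err)\<^sup>2 \<le> L err \<bullet> L err"
    using rip_lower by (simp add: power2_norm_eq_inner)
  also have "\<dots> = res \<bullet> L (X ** transpose X) - res \<bullet> L M - w \<bullet> L err"
    by (simp add: linear_diff[OF linear_L] inner_add_left inner_diff_right)
  finally show ?thesis
    using resM resX noise[of err] by (simp add: algebra_simps)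
qed

text \<open>The orthogonal splitting of the error, tested against \<open>h = 4 T - g\<close>. The lower bound on \<open>b\<close> enters
  twice: it makes \<open>X\<close> injective, and it turns the gradient term \<open>\<kappa> \<parallel>U\<parallel> \<le> \<kappa> \<parallel>T\<parallel> / \<surd>(2 b)\<close> into a
  multiple of \<open>\<surd>(2 \<kappa> (1 + \<delta>)) \<parallel>T\<parallel>\<close>.\<close>

lemma large_stretch_bound:
  assumes lower: "\<And>y. b * (norm y)\<^sup>2 \<le> (norm (X *v y))\<^sup>2"
    and v: "norm v = 1" "(norm (X *v v))\<^sup>2 = b"
    and large: "2 * \<epsilon> + \<kappa> < (1 + \<delta>) * b"
  shows "3/4 * (1 - 2 * \<delta>) * norm err
    \<le> 5/4 * \<epsilon> + \<kappa> / 2 * sqrt (real CARD('r)) + sqrt (2 * \<kappa> * (1 + \<delta>))"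
proof (cases "err = 0")
  case True
  then show ?thesis using eps kappa delta by simp
next
  case False
  have b: "b > 0"
    using large eps kappa delta by (smt (verit) mult_nonneg_nonpos)
  obtain Z :: "real^'r^'n" where Z: "M = Z ** transpose Z"
    using psd_factorization[OF psd_M rank_M] by blast
  obtain Y U :: "real^'r^'n" and B C :: "real^'r^'r" where
      tangent: "err + Y ** transpose Y = X ** transpose U + U ** transpose X"
    and orth: "(X ** transpose U + U ** transpose X) \<bullet> (Y ** transpose Y) = 0"
    and XY: "transpose X ** Y = 0"
    and Y_norm: "b * (norm Y)\<^sup>2
        \<le> (norm (X ** transpose U + U ** transpose X))\<^sup>2 + (norm (Y ** transpose Y))\<^sup>2 / 4"
    and U_norm: "2 * b * (norm U)\<^sup>2 \<le> (norm (X ** transpose U + U ** transpose X))\<^sup>2"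
    and Y_span: "Y = X ** B + Z ** C"
    using tangent_decomposition[OF b lower, of Z] unfolding Z by blast
  define T where "T = X ** transpose U + U ** transpose X"
  define g where "g = Y ** transpose Y"
  define h where "h = 4 *\<^sub>R T - g"
  define a c E \<tau> H where "a = norm g" and "c = norm T" and "E = norm err"
    and "\<tau> = (norm Y)\<^sup>2" and "H = norm h"
  note folded = T_def[symmetric] g_def[symmetric] a_def[symmetric] c_def[symmetric] \<tau>_def[symmetric]
  have err: "err = T - g"
    using tangent unfolding folded by (metis add_diff_cancel_right')
  have Tg: "T \<bullet> g = 0" "g \<bullet> T = 0"
    using orth by (simp_all add: folded inner_commute)
  have E_sq: "E\<^sup>2 = a\<^sup>2 + c\<^sup>2"
    unfolding E_def err a_def c_def power2_norm_eq_inner by (simp add: inner_diff Tg)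
  have H_sq: "H\<^sup>2 = a\<^sup>2 + 16 * c\<^sup>2"
    unfolding H_def h_def a_def c_def power2_norm_eq_inner by (simp add: inner_diff Tg)
  have nonneg: "0 \<le> a" "0 \<le> c" "0 < E" "0 \<le> H" "0 \<le> \<tau>"
    using False by (simp_all add: a_def c_def E_def H_def \<tau>_def)
  have HE: "H * E \<le> 5/4 * (a\<^sup>2 + 4 * c\<^sup>2)"
    using two_norm_bound[of a c] nonneg unfolding H_sq[symmetric] E_sq[symmetric] by simp
  have b\<tau>: "b * \<tau> \<le> (a\<^sup>2 + 4 * c\<^sup>2) / 4"
    using Y_norm by (simp add: folded)
  have \<tau>: "\<tau> \<le> sqrt (real CARD('r)) * a"
    unfolding \<tau>_def a_def g_def by (rule norm_power2_le_norm_gram)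
  have curv: "- (res \<bullet> L g) \<le> ((1 + \<delta>) * b + \<kappa> / 2) * \<tau>"
  proof -
    have "(norm (outer (X *v v) (column i Y) + outer (column i Y) (X *v v)))\<^sup>2
        \<le> 2 * b * (norm (column i Y))\<^sup>2" for i
    proof -
      have "transpose X *v column i Y = column i (transpose X ** Y)"
        by (simp add: vec_eq_iff column_def matrix_matrix_mult_def matrix_vector_mult_def)
      then have "transpose X *v column i Y = 0"
        by (simp add: XY column_def vec_eq_iff)
      then have "(X *v v) \<bullet> column i Y = 0"
        by (simp add: inner_matrix_vector)
      then show ?thesis
        unfolding power2_norm_eq_inner
        by (simp add: inner_add inner_outer inner_commute v(2)[unfolded power2_norm_eq_inner])
    qed
    from curvature_bound[OF v(1) this] show ?thesis
      by (simp add: g_def \<tau>_def algebra_simps)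
  qed
  have grad: "res \<bullet> L T \<le> \<kappa> * norm U"
    unfolding T_def by (rule first_order)
  have polar: "a\<^sup>2 + 4 * c\<^sup>2 - \<delta> * E * H \<le> L err \<bullet> L h"
  proof -
    have "rank (p *\<^sub>R err + q *\<^sub>R h) \<le> 2 * CARD('r)" for p q
    proof -
      \<comment> \<open>Every combination of \<open>err\<close> and \<open>h\<close> is a combination of \<open>err\<close> and \<open>g\<close>, since \<open>T = err + g\<close>; the
        columns of both lie in the span of those of \<open>X\<close> and \<open>Z\<close>.\<close>
      define x y where "x = p + 4 * q" and "y = 3 * q"
      have "p *\<^sub>R err + q *\<^sub>R h = x *\<^sub>R err + y *\<^sub>R g"
        by (simp add: h_def err x_def y_def algebra_simps vec_eq_iff)
      also have "\<dots> = X ** (x *\<^sub>R transpose X + y *\<^sub>R (B ** transpose Y))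
          + Z ** (y *\<^sub>R (C ** transpose Y) - x *\<^sub>R transpose Z)"
      proof -
        have "g = X ** (B ** transpose Y) + Z ** (C ** transpose Y)"
          unfolding g_def by (subst Y_span) (simp add: matrix_mult.add_left matrix_mul_assoc)
        then show ?thesis
          by (simp add: Z matrix_mult.add_right matrix_mult.diff_right matrix_mult.scaleR_right
              scaleR_right_distrib scaleR_right_diff_distrib)
      qed
      finally show ?thesis
        by (metis rank_le_of_two_factors)
    qed
    note combo = rip_lower[OF this] rip_upper[OF this]
    have "err \<bullet> h = a\<^sup>2 + 4 * c\<^sup>2"
      unfolding a_def c_def power2_norm_eq_inner h_def err by (simp add: inner_diff Tg)
    then show ?thesis
      using polarized_lower_bound[OF linear_L combo] by (simp add: E_def H_def)
  qed
  have \<kappa>U: "2 * (\<kappa> * norm U) \<le> sqrt (2 * \<kappa> * (1 + \<delta>)) * c"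
  proof (rule power2_le_imp_le)
    have "\<kappa> \<le> (1 + \<delta>) * b" using large eps by simp
    then have sq: "\<kappa> * \<kappa> * (norm U)\<^sup>2 \<le> \<kappa> * ((1 + \<delta>) * b) * (norm U)\<^sup>2"
      using kappa by (intro mult_right_mono mult_left_mono) simp_all
    have "(2 * (\<kappa> * norm U))\<^sup>2 = 4 * (\<kappa> * \<kappa> * (norm U)\<^sup>2)"
      by (simp add: power2_eq_square)
    also have "\<dots> \<le> 4 * (\<kappa> * ((1 + \<delta>) * b) * (norm U)\<^sup>2)"
      using sq by simp
    also have "\<dots> = 2 * \<kappa> * (1 + \<delta>) * (2 * b * (norm U)\<^sup>2)"
      by simp
    also have "\<dots> \<le> 2 * \<kappa> * (1 + \<delta>) * c\<^sup>2"
      using U_norm kappa delta by (intro mult_left_mono) (simp_all add: folded)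
    finally show "(2 * (\<kappa> * norm U))\<^sup>2 \<le> (sqrt (2 * \<kappa> * (1 + \<delta>)) * c)\<^sup>2"
      using kappa delta by (simp add: power_mult_distrib)
  qed (use kappa delta nonneg in simp)
  \<comment> \<open>Multiplying by \<open>E\<close> makes every term comparable with \<open>P\<close>, which then cancels.\<close>
  define P where "P = a\<^sup>2 + 4 * c\<^sup>2"
  have EP: "E\<^sup>2 \<le> P" "2 * c * E \<le> P" "a * E \<le> P"
  proof -
    show "E\<^sup>2 \<le> P" by (simp add: E_sq P_def)
    show "2 * c * E \<le> P"
      using sum_squares_bound[of c E] E_sq zero_le_power2[of c] unfolding P_def by linarith
    show "a * E \<le> P"
      using sum_squares_bound[of a E] E_sq zero_le_power2[of c] unfolding P_def by linarith
  qed
  have P: "P > 0" using zero_less_power[OF nonneg(3), of 2] EP(1) by linarith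
  have "L err \<bullet> L h = 4 * (res \<bullet> L T) - res \<bullet> L g - w \<bullet> L h"
    by (simp add: h_def linear_diff[OF linear_L] linear_cmul[OF linear_L] inner_add_left
        inner_diff_right algebra_simps)
  also have "\<dots> \<le> 4 * (\<kappa> * norm U) + ((1 + \<delta>) * b + \<kappa> / 2) * \<tau> + \<epsilon> * H"
    using grad curv noise[of h] by (simp add: H_def)
  finally have "P - \<delta> * E * H \<le> 4 * (\<kappa> * norm U) + ((1 + \<delta>) * b + \<kappa> / 2) * \<tau> + \<epsilon> * H"
    using polar by (simp add: P_def)
  moreover have "\<delta> * E * H \<le> \<delta> * (5/4 * P)"
    using mult_left_mono[OF HE delta(1)] by (simp add: P_def mult_ac)
  moreover have "(1 + \<delta>) * (b * \<tau>) \<le> (1 + \<delta>) * (P / 4)"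
    using b\<tau> delta by (intro mult_left_mono) (simp_all add: P_def)
  ultimately have "3/4 * (1 - 2 * \<delta>) * P
      \<le> 2 * (sqrt (2 * \<kappa> * (1 + \<delta>)) * c) + \<kappa> / 2 * \<tau> + \<epsilon> * H"
    using \<kappa>U by (simp add: algebra_simps)
  then have "3/4 * (1 - 2 * \<delta>) * P * E
      \<le> (2 * (sqrt (2 * \<kappa> * (1 + \<delta>)) * c) + \<kappa> / 2 * \<tau> + \<epsilon> * H) * E"
    using nonneg(3) by (intro mult_right_mono) simp_all
  also have "\<dots> = sqrt (2 * \<kappa> * (1 + \<delta>)) * (2 * c * E) + \<kappa> / 2 * (\<tau> * E) + \<epsilon> * (H * E)"
    by (simp add: algebra_simps)
  also have "\<dots> \<le> sqrt (2 * \<kappa> * (1 + \<delta>)) * P + \<kappa> / 2 * (sqrt (real CARD('r)) * P) + \<epsilon> * (5/4 * P)"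
  proof (intro add_mono mult_left_mono)
    have "\<tau> * E \<le> sqrt (real CARD('r)) * a * E"
      using \<tau> nonneg(3) by (intro mult_right_mono) simp_all
    also have "\<dots> \<le> sqrt (real CARD('r)) * P"
      using EP(3) by (simp add: mult.assoc mult_left_mono)
    finally show "\<tau> * E \<le> sqrt (real CARD('r)) * P" .
  qed (use EP HE kappa eps delta in \<open>simp_all add: P_def\<close>)
  finally have "P * (3/4 * (1 - 2 * \<delta>) * E)
      \<le> P * (5/4 * \<epsilon> + \<kappa> / 2 * sqrt (real CARD('r)) + sqrt (2 * \<kappa> * (1 + \<delta>)))"
    by (simp add: algebra_simps)
  then show ?thesis using P by (simp add: E_def)
qed

text \<open>The two regimes combined. Passing to the stated constants uses \<open>r \<ge> 1\<close>, \<open>1 + \<delta> \<ge> 1\<close>,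
  subadditivity of the square root and nonnegativity of the last term of the second alternative.\<close>

lemma error_bounds:
  fixes r :: nat
  assumes r: "r = CARD('r)"
  defines "e \<equiv> norm err" and "s \<equiv> norm M"
  shows "(1 - \<delta>) * e\<^sup>2
      \<le> \<epsilon> * sqrt r * e + r powr (1/4) * \<kappa> / 2 * sqrt e + r powr (1/4) * \<kappa> / 2 * sqrt s
        + (4 * sqrt r * \<epsilon> + 5 * sqrt r * \<kappa> / 2) * s
    \<or> 2 * (1 - 2 * \<delta>) / (3 * (1 + \<delta>)) * e
      \<le> (2 * \<epsilon> + \<kappa>) * sqrt r + sqrt (2 * \<kappa> * (1 + \<delta>))
        + 2 * sqrt (2 * \<epsilon> * (1 + \<delta>)) * (sqrt e + sqrt s)"
proof -
  have r1: "1 \<le> sqrt (real r)" using r by simp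
  have nonneg: "0 \<le> e" "0 \<le> s" by (simp_all add: e_def s_def)
  obtain v where v: "norm v = 1" "\<And>y. (norm (X *v v))\<^sup>2 * (norm y)\<^sup>2 \<le> (norm (X *v y))\<^sup>2"
    using ex_min_stretch by blast
  show ?thesis
  proof (cases "(1 + \<delta>) * (norm (X *v v))\<^sup>2 \<le> 2 * \<epsilon> + \<kappa>")
    case True
    have "(real r) powr (1/4) = sqrt (sqrt (real r))"
      using r by (simp add: powr_half_sqrt[symmetric] powr_powr)
    moreover have "sqrt (e + s) \<le> sqrt e + sqrt s"
      using nonneg by (rule sqrt_add_le_add_sqrt)
    ultimately have "\<kappa> / 2 * sqrt (sqrt (real r) * (e + s))
        \<le> \<kappa> / 2 * (r powr (1/4) * (sqrt e + sqrt s))"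
      using kappa by (intro mult_left_mono) (simp_all add: real_sqrt_mult mult_left_mono)
    moreover have "\<epsilon> * e \<le> \<epsilon> * sqrt r * e"
      using mult_right_mono[OF mult_left_mono[OF r1 eps] nonneg(1)] by simp
    ultimately show ?thesis
      using small_stretch_bound[OF v(1) True] unfolding r[symmetric] e_def[symmetric] s_def[symmetric]
      by (intro disjI1) (simp add: algebra_simps)
  next
    case False
    define t where "t = 2 * (1 - 2 * \<delta>) / (3 * (1 + \<delta>)) * e"
    \<comment> \<open>\<open>8/9\<close> is the ratio of the leading constants \<open>2/3\<close> and \<open>3/4\<close>.\<close>
    have "t = 8/9 / (1 + \<delta>) * (3/4 * (1 - 2 * \<delta>) * e)"
      using delta by (simp add: t_def field_simps)
    also have "\<dots> \<le> 1 * (3/4 * (1 - 2 * \<delta>) * e)"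
    proof (rule mult_right_mono)
      show "8/9 / (1 + \<delta>) \<le> 1" using delta by (simp add: field_simps)
      show "0 \<le> 3/4 * (1 - 2 * \<delta>) * e"
        using delta nonneg by (intro mult_nonneg_nonneg) simp_all
    qed
    finally have t_le: "t \<le> 3/4 * (1 - 2 * \<delta>) * e" by simp
    also have "\<dots> \<le> 5/4 * \<epsilon> + \<kappa> / 2 * sqrt r + sqrt (2 * \<kappa> * (1 + \<delta>))"
      using large_stretch_bound[OF v(2) v(1) refl] False unfolding r e_def by simp
    also have "5/4 * \<epsilon> + \<kappa> / 2 * sqrt r \<le> (2 * \<epsilon> + \<kappa>) * sqrt r"
      using mult_left_mono[OF r1 eps] mult_left_mono[OF r1 kappa] eps kappa
      by (simp add: algebra_simps)
    finally have "t \<le> (2 * \<epsilon> + \<kappa>) * sqrt r + sqrt (2 * \<kappa> * (1 + \<delta>))" by simp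
    moreover have "0 \<le> 2 * sqrt (2 * \<epsilon> * (1 + \<delta>)) * (sqrt e + sqrt s)"
      using eps delta nonneg by simp
    ultimately show ?thesis unfolding t_def by linarith
  qed
qed

end

section \<open>Gradient and Hessian of the objective\<close>

lemma linear_sensing_op: "linear (sensing_op A)"
  by (rule linearI) (simp_all add: vec_eq_iff sensing_op_def mat_inner_eq_inner inner_add_right)

lemma inner_sensing_op: "y \<bullet> sensing_op A N = (\<Sum>k\<in>UNIV. y $ k * (A k \<bullet> N))"
  for A :: "'m::finite \<Rightarrow> real^'c^'d"
  by (simp add: inner_vec_def[of y] sensing_op_def mat_inner_eq_inner)

lemma inner_vectorize: "vectorize X \<bullet> vectorize Y = X \<bullet> Y" for X Y :: "real^'c^'d"
proof -
  have "vectorize X \<bullet> vectorize Y = (\<Sum>j\<in>UNIV. \<Sum>i\<in>UNIV. X $ i $ j * Y $ i $ j)"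
    unfolding sum.cartesian_product UNIV_Times_UNIV
    by (simp add: inner_vec_def vectorize_def case_prod_beta)
  also have "\<dots> = X \<bullet> Y"
    by (subst sum.swap) (simp add: inner_vec_def)
  finally show ?thesis .
qed

lemma norm_vectorize: "norm (vectorize X) = norm X" for X :: "real^'c^'d"
  by (simp add: norm_eq_sqrt_inner inner_vectorize)

lemma bounded_linear_vectorize: "bounded_linear vectorize"
  unfolding linear_conv_bounded_linear[symmetric]
  by (rule linearI) (simp_all add: vec_eq_iff vectorize_def)

lemma bounded_linear_unvectorize: "bounded_linear unvectorize"
  unfolding linear_conv_bounded_linear[symmetric]
  by (rule linearI) (simp_all add: vec_eq_iff unvectorize_def)

text \<open>The gradient in matrix form. The sensing matrices are symmetrized because they multiply
  \<open>X U\<^sup>T + U X\<^sup>T\<close> but need not be symmetric themselves.\<close>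

definition objective_grad ::
    "('m::finite \<Rightarrow> real^'n^'n) \<Rightarrow> real^'m \<Rightarrow> real^'m \<Rightarrow> real^'r^'n \<Rightarrow> real^'r^'n" where
  "objective_grad A b w X = (\<Sum>k\<in>UNIV.
     (sensing_op A (X ** transpose X) - b + w) $ k *\<^sub>R ((A k + transpose (A k)) ** X))"

definition objective_grad_deriv ::
    "('m::finite \<Rightarrow> real^'n^'n) \<Rightarrow> real^'m \<Rightarrow> real^'m \<Rightarrow> real^'r^'n \<Rightarrow> real^'r^'n \<Rightarrow> real^'r^'n" where
  "objective_grad_deriv A b w X U = (\<Sum>k\<in>UNIV.
     (sensing_op A (X ** transpose X) - b + w) $ k *\<^sub>R ((A k + transpose (A k)) ** U)
     + sensing_op A (X ** transpose U + U ** transpose X) $ k *\<^sub>R ((A k + transpose (A k)) ** X))"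

lemma inner_symmetrized:
  "((A + transpose A) ** X) \<bullet> U = A \<bullet> (X ** transpose U + U ** transpose X)"
  for A :: "real^'n^'n" and X U :: "real^'r^'n"
proof -
  have "A \<bullet> (X ** transpose U) = (transpose A ** X) \<bullet> U"
    using inner_matrix_mult_right[of X "transpose U" A] inner_matrix_mult_left[of "transpose A" X U]
    by (simp add: inner_commute)
  moreover have "A \<bullet> (U ** transpose X) = (A ** X) \<bullet> U"
    using inner_matrix_mult_right[of U "transpose X" A] by (simp add: inner_commute)
  ultimately show ?thesis
    by (simp add: matrix_mult.add_left inner_add_left inner_add_right)
qed

lemma inner_objective_grad:
  "objective_grad A b w X \<bullet> U
     = (sensing_op A (X ** transpose X) - b + w) \<bullet> sensing_op A (X ** transpose U + U ** transpose X)"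
  by (simp only: objective_grad_def inner_sum_left inner_scaleR_left inner_symmetrized inner_sensing_op)

text \<open>On the diagonal the derivative of the gradient is the Hessian quadratic form. The factor \<open>2\<close> is
  \<open>U U\<^sup>T + U U\<^sup>T\<close>, from the symmetrized sensing matrices.\<close>

lemma inner_objective_grad_deriv:
  "objective_grad_deriv A b w X U \<bullet> U
     = (norm (sensing_op A (X ** transpose U + U ** transpose X)))\<^sup>2
       + 2 * ((sensing_op A (X ** transpose X) - b + w) \<bullet> sensing_op A (U ** transpose U))"
proof -
  have "objective_grad_deriv A b w X U \<bullet> U
      = (sensing_op A (X ** transpose X) - b + w) \<bullet> sensing_op A (U ** transpose U + U ** transpose U)
        + sensing_op A (X ** transpose U + U ** transpose X)
          \<bullet> sensing_op A (X ** transpose U + U ** transpose X)"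
    by (simp only: objective_grad_deriv_def inner_sum_left inner_add_left
        inner_scaleR_left inner_symmetrized inner_sensing_op sum.distrib)
  moreover have "sensing_op A (U ** transpose U + U ** transpose U)
      = 2 *\<^sub>R sensing_op A (U ** transpose U)"
    unfolding linear_add[OF linear_sensing_op] by (simp add: scaleR_2)
  ultimately show ?thesis
    by (simp only: power2_norm_eq_inner inner_scaleR_right)
qed

lemma has_derivative_gram:
  "((\<lambda>X. X ** transpose X) has_derivative (\<lambda>U. X ** transpose U + U ** transpose X)) (at X)"
  for X :: "real^'r^'n"
  by (rule matrix_mult.FDERIV[OF has_derivative_ident
        bounded_linear.has_derivative[OF bounded_linear_transpose has_derivative_ident]])

lemma has_derivative_residual:
  "((\<lambda>X. sensing_op A (X ** transpose X) - b + w) has_derivative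
     (\<lambda>U. sensing_op A (X ** transpose U + U ** transpose X))) (at X)"
  for X :: "real^'r^'n" and A :: "'m::finite \<Rightarrow> real^'n^'n"
proof -
  have "((\<lambda>X. sensing_op A (X ** transpose X)) has_derivative
     (\<lambda>U. sensing_op A (X ** transpose U + U ** transpose X))) (at X)"
    by (rule bounded_linear.has_derivative[OF linear_sensing_op[unfolded linear_conv_bounded_linear]
          has_derivative_gram])
  from has_derivative_add[OF has_derivative_diff[OF this has_derivative_const[of b]]
      has_derivative_const[of w]]
  show ?thesis by simp
qed

lemma has_derivative_objective:
  "(objective A b w has_derivative (\<lambda>U. objective_grad A b w X \<bullet> U)) (at X)"
  for X :: "real^'r^'n"
  unfolding objective_def[abs_def] power2_norm_eq_inner inner_objective_grad
  using bounded_linear.has_derivative[OF bounded_linear_mult_right[of "1/2"]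
      has_derivative_inner[OF has_derivative_residual[of A b w X] has_derivative_residual[of A b w X]]]
  by (simp add: inner_commute)

lemma has_derivative_objective_grad:
  "(objective_grad A b w has_derivative objective_grad_deriv A b w X) (at X)"
  for X :: "real^'r^'n" and A :: "'m::finite \<Rightarrow> real^'n^'n"
proof -
  have res: "((\<lambda>X. (sensing_op A (X ** transpose X) - b + w) $ k) has_derivative
     (\<lambda>U. sensing_op A (X ** transpose U + U ** transpose X) $ k)) (at X)" for k
    by (rule bounded_linear.has_derivative[OF bounded_linear_vec_nth has_derivative_residual])
  have lin: "((\<lambda>X. (A k + transpose (A k)) ** X) has_derivative (\<lambda>U. (A k + transpose (A k)) ** U)) (at X)" for k
    by (rule bounded_linear.has_derivative[OF matrix_mult.bounded_linear_right has_derivative_ident])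
  show ?thesis
    unfolding objective_grad_def[abs_def] objective_grad_deriv_def[abs_def]
    by (intro has_derivative_sum has_derivative_scaleR res lin)
qed

lemma gradient_unvectorize:
  fixes f :: "real^'c^'d \<Rightarrow> real"
  assumes "(f has_derivative (\<lambda>U. G \<bullet> U)) (at (unvectorize v))"
  shows "gradient (\<lambda>v. f (unvectorize v)) v = vectorize G"
proof (rule gradient_eqI)
  have "((\<lambda>v. f (unvectorize v)) has_derivative (\<lambda>h. G \<bullet> unvectorize h)) (at v)"
    by (rule has_derivative_compose[OF bounded_linear.has_derivative[OF bounded_linear_unvectorize
          has_derivative_ident] assms])
  moreover have "G \<bullet> unvectorize h = h \<bullet> vectorize G" for h
    using inner_vectorize[of "unvectorize h" G] by (simp add: inner_commute)
  ultimately show "GDERIV (\<lambda>v. f (unvectorize v)) v :> vectorize G"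
    by (simp add: gderiv_def)
qed

lemma vec_gradient_objective:
  "vec_gradient (objective A b w) X = vectorize (objective_grad A b w X)"
  unfolding vec_gradient_def by (simp add: gradient_unvectorize[OF has_derivative_objective])

lemma vec_hessian_objective:
  "vec_hessian (objective A b w) X
     = matrix (\<lambda>h. vectorize (objective_grad_deriv A b w X (unvectorize h)))"
  and vec_hessian_objective_mult:
  "vec_hessian (objective A b w) X *v vectorize U = vectorize (objective_grad_deriv A b w X U)"
  for X U :: "real^'r^'n"
proof -
  have grad: "gradient (\<lambda>v. objective A b w (unvectorize v :: real^'r^'n))
      = (\<lambda>v. vectorize (objective_grad A b w (unvectorize v)))"
    by (rule ext) (rule gradient_unvectorize[OF has_derivative_objective])
  have D: "((\<lambda>v. vectorize (objective_grad A b w (unvectorize v :: real^'r^'n))) has_derivative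
      (\<lambda>h. vectorize (objective_grad_deriv A b w X (unvectorize h)))) (at (vectorize X))"
    by (rule bounded_linear.has_derivative[OF bounded_linear_vectorize])
      (rule has_derivative_compose[OF bounded_linear.has_derivative[OF bounded_linear_unvectorize
          has_derivative_ident]], simp, rule has_derivative_objective_grad)
  show H: "vec_hessian (objective A b w) X
     = matrix (\<lambda>h. vectorize (objective_grad_deriv A b w X (unvectorize h)))"
    unfolding vec_hessian_def hessian_def grad jacobian_def frechet_derivative_at[OF D, symmetric] ..
  show "vec_hessian (objective A b w) X *v vectorize U = vectorize (objective_grad_deriv A b w X U)"
    unfolding H using has_derivative_linear[OF D] by (simp add: matrix_works linear_matrix_vector_mul_eq)
qed

section \<open>Measurability of the good event\<close>

lemma closed_pos_semidef: "closed {H :: real^'k^'k. pos_semidef H}"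
  unfolding pos_semidef_def matrix_vector_mult_def
  by (intro closed_Collect_conj closed_Collect_all closed_Collect_eq closed_Collect_le
      continuous_intros continuous_on_vec_lambda bounded_linear.continuous_on[OF bounded_linear_transpose])

text \<open>Gradient and Hessian are polynomial in \<open>(X, w)\<close>, and the positive semidefinite cone is closed.\<close>

lemma closed_approx_stationary:
  fixes A :: "'m::finite \<Rightarrow> real^'n^'n"
  shows "closed {(X :: real^'r^'n, w). norm (vec_gradient (objective A b w) X) \<le> \<kappa> \<and>
      vec_hessian (objective A b w) X \<succeq> (- \<kappa>) *\<^sub>R mat 1}"
proof -
  have L: "continuous_on S (sensing_op A)" for S
    by (rule linear_continuous_on[OF linear_sensing_op[unfolded linear_conv_bounded_linear]])
  have T: "continuous_on S (transpose :: real^'r^'n \<Rightarrow> _)" for S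
    by (rule linear_continuous_on[OF bounded_linear_transpose])
  have "continuous_on UNIV (\<lambda>p :: (real^'r^'n) \<times> (real^'m). vec_gradient (objective A b (snd p)) (fst p))"
    unfolding vec_gradient_objective objective_grad_def
    by (intro linear_continuous_on_compose[OF _ bounded_linear.linear[OF bounded_linear_vectorize]]
      continuous_intros matrix_mult.continuous_on continuous_on_compose2[OF L] continuous_on_compose2[OF T]) auto
  moreover have "continuous_on UNIV (\<lambda>p :: (real^'r^'n) \<times> (real^'m). vec_hessian (objective A b (snd p)) (fst p))"
    unfolding vec_hessian_objective matrix_def objective_grad_deriv_def vectorize_def
    by (intro continuous_on_vec_lambda 
      continuous_intros matrix_mult.continuous_on continuous_on_compose2[OF L] continuous_on_compose2[OF T]) auto
  ultimately have "closed {p :: (real^'r^'n) \<times> (real^'m). norm (vec_gradient (objective A b (snd p)) (fst p)) \<le> \<kappa> \<and>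
      vec_hessian (objective A b (snd p)) (fst p) - (- \<kappa>) *\<^sub>R mat 1 \<in> {H. pos_semidef H}}"
    by (intro closed_Collect_conj closed_Collect_le continuous_intros 
       closed_vimage[OF closed_pos_semidef, unfolded vimage_def]) auto
  then show ?thesis unfolding psd_ge_def case_prod_unfold by simp
qed

text \<open>The complement is the projection to the second factor of the part of a closed set lying over an open
  set of \<open>x\<close>.
  Projections of Borel sets need not be Borel, but an open set is a countable union of compact sets,
  and projecting a closed set along a compact one gives a closed set.\<close>

lemma borel_forall_closed_imp:
  fixes P :: "'a::euclidean_space \<Rightarrow> 'b::euclidean_space \<Rightarrow> bool"
  assumes P: "closed {(x, y). P x y}" and Q: "closed {x. Q x}"
  shows "{y. \<forall>x. P x y \<longrightarrow> Q x} \<in> sets borel"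
proof -
  obtain C where C: "\<And>n::nat. compact (C n)" "\<Union>(range C) = - {x. Q x}"
    using open_Union_compact_subsets[of "- {x. Q x}"] Q by (metis open_Compl)
  have "{y. \<forall>x. P x y \<longrightarrow> Q x} = - (\<Union>n. {y. \<exists>x. x \<in> C n \<and> (x, y) \<in> {(x, y). P x y}})"
    using C(2) by blast
  moreover have "closed {y. \<exists>x. x \<in> C n \<and> (x, y) \<in> {(x, y). P x y}}" for n
    by (rule closed_compact_projection[OF C(1) P])
  ultimately show ?thesis by auto
qed

section \<open>The high-probability statement\<close>

text \<open>\<open>\<^bold>A\<^sup>T w\<close> represents \<open>N \<mapsto> \<langle>w, \<A> N\<rangle>\<close> on vectorized matrices.\<close>

lemma inner_noise_bound:
  fixes A :: "'m::finite \<Rightarrow> real^'n^'n"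
  assumes "norm (transpose (sensing_matrix A) *v w) \<le> \<epsilon>"
  shows "\<bar>w \<bullet> sensing_op A N\<bar> \<le> \<epsilon> * norm N"
proof -
  have "w \<bullet> sensing_op A N = (transpose (sensing_matrix A) *v w) \<bullet> vectorize N"
    by (simp add: dot_lmul_matrix sensing_matrix_mult_vectorize)
  also have "\<bar>\<dots>\<bar> \<le> norm (transpose (sensing_matrix A) *v w) * norm (vectorize N)"
    by (rule Cauchy_Schwarz_ineq2)
  also have "\<dots> \<le> \<epsilon> * norm N"
    using assms by (simp add: norm_vectorize mult_right_mono)
  finally show ?thesis .
qed

text \<open>The gradient bound is tested against each direction by Cauchy-Schwarz, the Hessian bound by
  evaluating its quadratic form there.\<close>

lemma noisy_stationary_pointI:
  fixes A :: "'m::finite \<Rightarrow> real^'n^'n" and X :: "real^'r^'n"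
  assumes "pos_semidef M" "rank M \<le> CARD('r)" "b = sensing_op A M"
    and "0 \<le> \<delta>" "\<delta> < 1/2" "RIP \<delta> (2 * CARD('r)) (sensing_op A)" "\<epsilon> > 0" "\<kappa> \<ge> 0"
    and noise: "norm (transpose (sensing_matrix A) *v w) \<le> \<epsilon>"
    and grad: "norm (vec_gradient (objective A b w) X) \<le> \<kappa>"
    and hess: "vec_hessian (objective A b w) X \<succeq> (- \<kappa>) *\<^sub>R mat 1"
  shows "noisy_stationary_point (sensing_op A) M w X \<delta> \<epsilon> \<kappa>"
proof (rule noisy_stationary_point.intro)
  have res: "sensing_op A (X ** transpose X) - b + w = sensing_op A (X ** transpose X - M) + w"
    using assms(3) by (simp add: linear_diff[OF linear_sensing_op])
  fix U :: "real^'r^'n"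
  have "objective_grad A b w X \<bullet> U \<le> norm (objective_grad A b w X) * norm U"
    by (rule norm_cauchy_schwarz)
  also have "\<dots> \<le> \<kappa> * norm U"
    using grad by (simp add: vec_gradient_objective norm_vectorize mult_right_mono)
  finally show "(sensing_op A (X ** transpose X - M) + w) \<bullet> sensing_op A (X ** transpose U + U ** transpose X)
      \<le> \<kappa> * norm U"
    unfolding inner_objective_grad res .
  have "0 \<le> vectorize U \<bullet> ((vec_hessian (objective A b w) X - (- \<kappa>) *\<^sub>R mat 1) *v vectorize U)"
    using hess unfolding psd_ge_def pos_semidef_def by blast
  also have "\<dots> = objective_grad_deriv A b w X U \<bullet> U + \<kappa> * (norm U)\<^sup>2"
    by (simp add: matrix_vector_mult_add_rdistrib vec_hessian_objective_mult inner_add_right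
        inner_vectorize inner_commute power2_norm_eq_inner scaleR_matrix_vector_assoc[symmetric])
  finally show "- \<kappa> * (norm U)\<^sup>2 \<le> (norm (sensing_op A (X ** transpose U + U ** transpose X)))\<^sup>2
      + 2 * ((sensing_op A (X ** transpose X - M) + w) \<bullet> sensing_op A (U ** transpose U))"
    unfolding inner_objective_grad_deriv res by simp
qed (use assms inner_noise_bound[OF noise] in \<open>auto intro: linear_sensing_op\<close>)

theorem theorem5:
  fixes A :: "'m::finite \<Rightarrow> real^'n^'n"
    and Mstar :: "real^'n^'n"
    and \<Omega> :: "'a measure"
    and w :: "'a \<Rightarrow> real^'m"
    and \<delta> \<epsilon> \<kappa> :: real
    and b :: "real^'m"
    and r :: nat
  assumes "pos_semidef Mstar"
    and "r = CARD('r::finite)"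
    and "rank Mstar = r"
    and "b = sensing_op A Mstar"
    and "prob_space \<Omega>"
    and "w \<in> borel_measurable \<Omega>"
    and "0 \<le> \<delta>" and "\<delta> < 1/2"
    and "RIP \<delta> (2 * r) (sensing_op A)"
    and "\<epsilon> > 0" and "\<kappa> \<ge> 0"
  shows "\<P>(\<omega> in \<Omega>. \<forall>X :: real^'r^'n.
           norm (vec_gradient (objective A b (w \<omega>)) X) \<le> \<kappa> \<and>
           vec_hessian (objective A b (w \<omega>)) X \<succeq> (- \<kappa>) *\<^sub>R mat 1 \<longrightarrow>
           (let e = frob_norm (X ** transpose X - Mstar); s = frob_norm Mstar in
             (1 - \<delta>) * e\<^sup>2
               \<le> \<epsilon> * sqrt r * e
                 + r powr (1/4) * \<kappa> / 2 * sqrt e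
                 + r powr (1/4) * \<kappa> / 2 * sqrt s
                 + (4 * sqrt r * \<epsilon> + 5 * sqrt r * \<kappa> / 2) * s
             \<or> 2 * (1 - 2 * \<delta>) / (3 * (1 + \<delta>)) * e
               \<le> (2 * \<epsilon> + \<kappa>) * sqrt r
                 + sqrt (2 * \<kappa> * (1 + \<delta>))
                 + 2 * sqrt (2 * \<epsilon> * (1 + \<delta>)) * (sqrt e + sqrt s)))
         \<ge> \<P>(\<omega> in \<Omega>. norm (transpose (sensing_matrix A) *v w \<omega>) \<le> \<epsilon>)"
    (is "\<P>(\<omega> in \<Omega>. \<forall>X. ?stationary X (w \<omega>) \<longrightarrow> ?bounds X) \<ge> _")
proof -
  interpret prob_space \<Omega> by fact
  have "closed {X. ?bounds X}"
    unfolding Let_def frob_norm_eq_norm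
    by (intro closed_Collect_disj closed_Collect_le continuous_intros matrix_mult.continuous_on
        bounded_linear.continuous_on[OF bounded_linear_transpose])
  then have "{y. \<forall>X. ?stationary X y \<longrightarrow> ?bounds X} \<in> sets borel"
    by (rule borel_forall_closed_imp[OF closed_approx_stationary])
  with \<open>w \<in> borel_measurable \<Omega>\<close>
  have "w -` {y. \<forall>X. ?stationary X y \<longrightarrow> ?bounds X} \<inter> space \<Omega> \<in> events"
    by (rule measurable_sets)
  moreover have "w -` {y. \<forall>X. ?stationary X y \<longrightarrow> ?bounds X} \<inter> space \<Omega>
      = {\<omega> \<in> space \<Omega>. \<forall>X. ?stationary X (w \<omega>) \<longrightarrow> ?bounds X}"
    by blast
  ultimately have "{\<omega> \<in> space \<Omega>. \<forall>X. ?stationary X (w \<omega>) \<longrightarrow> ?bounds X} \<in> events"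
    by (simp only:)
  moreover have "?bounds X"
    if "norm (transpose (sensing_matrix A) *v w \<omega>) \<le> \<epsilon>" "?stationary X (w \<omega>)" for X \<omega>
  proof -
    have "noisy_stationary_point (sensing_op A) Mstar (w \<omega>) X \<delta> \<epsilon> \<kappa>"
      using assms that by (intro noisy_stationary_pointI) auto
    from noisy_stationary_point.error_bounds[OF this \<open>r = CARD('r)\<close>]
    show ?thesis by (simp only: Let_def frob_norm_eq_norm)
  qed
  ultimately show ?thesis
    by (intro finite_measure_mono) auto
qed

end
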